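(* Let $n\ge2$ and let $\Omega\subset\mathbb R^n$ be an admissible domain with $\partial\Omega=\mathcal F\cup\mathcal B$ satisfying the John condition $\Omega\subset\mathcal F\times(-\infty,0)$. Let $\nu_1\le\nu_2\le\cdots$ be its sloshing eigenvalues. Then for every integer $k\ge1$ $$\frac1k\sum_{j=1}^k\nu_j\le\frac{n-1}{n}\left(W_{n,k}-\frac{1}{W_{n,k}}(\nu_{k+1}-W_{n,k})^2\right),\qquad W_{n,k}:=2\pi\,\omega_{n-1}^{-\frac{1}{n-1}}\left(\frac{k}{|\mathcal F|}\right)^{\frac1{n-1}}.$$ In particular, $$W_{n,k}\bigl(1-\sqrt{1-S_k}\bigr)\le\nu_{k+1}\le W_{n,k}\bigl(1+\sqrt{1-S_k}\bigr),\qquad S_k:=\frac{n}{n-1}\,\frac{\sum_{j=1}^k\nu_j}{k\,W_{n,k}}.$$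
   Context: Admissible domain in $\mathbb R^n$: a bounded domain $\Omega\subset\mathbb R^n$ with Lipschitz, piecewise smooth boundary $\partial\Omega=\mathcal F\cup\mathcal B$, $\mathcal F\subset\{x_n=0\}$, $\mathcal B\subset\{x_n<0\}$, where $\mathcal F$ has positive $(n-1)$-dimensional measure $|\mathcal F|$. $\mathcal F$ is identified with a subset of $\mathbb R^{n-1}$. Sloshing (Steklov--Neumann) eigenvalues of $\Omega$: the numbers $0=\nu_1\le\nu_2\le\cdots\nearrow\infty$ (counted with multiplicity) for which $\Delta f=0$ in $\Omega$, $\partial f/\partial\mathbf n=0$ on $\mathcal B$, $\partial f/\partial x_n=\nu f$ on $\mathcal F$ has a nontrivial (weak) solution; equivalently, the eigenvalues given by min-max for $\int_\Omega|\nabla f|^2dx/\int_{\mathcal F}|f|^2ds$, $f\in H^1(\Omega)$. $\omega_{n-1}=\pi^{\frac{n-1}2}/\Gamma(\frac{n+1}{2})$ is the volume of the unit ball in $\mathbb R^{n-1}$. *)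

theory Defs
  imports "HOL-Analysis.Analysis"
begin

text \<open>
  The ambient space \<open>\<real>\<^sup>n\<close> is the Euclidean space \<open>'a \<times> real\<close> with \<open>DIM('a) = n - 1 \<ge> 1\<close>: the last
  coordinate \<open>x\<^sub>n\<close> is \<open>snd x\<close>. The free surface is given as a set \<open>F\<close> of points of \<open>'a\<close>; as a part of
  the boundary it is \<open>F \<times> {0}\<close>.
\<close>

section \<open>Smooth functions and gradients\<close>

primrec Ck_on :: "nat \<Rightarrow> ('a::real_normed_vector \<Rightarrow> 'b::real_normed_vector) \<Rightarrow> 'a set \<Rightarrow> bool" where
  "Ck_on 0 f U \<longleftrightarrow> continuous_on U f"
| "Ck_on (Suc k) f U \<longleftrightarrow>
     (\<forall>x\<in>U. f differentiable (at x)) \<and> (\<forall>v. Ck_on k (\<lambda>x. frechet_derivative f (at x) v) U)"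

text \<open>Used for open \<open>U\<close> only.\<close>

definition smooth_on :: "('a::real_normed_vector \<Rightarrow> 'b::real_normed_vector) \<Rightarrow> 'a set \<Rightarrow> bool" where
  "smooth_on f U \<longleftrightarrow> (\<forall>k. Ck_on k f U)"

definition grad :: "('a::euclidean_space \<Rightarrow> real) \<Rightarrow> 'a \<Rightarrow> 'a" where
  "grad f x = (\<Sum>b\<in>Basis. frechet_derivative f (at x) b *\<^sub>R b)"

definition test_function :: "'a::euclidean_space set \<Rightarrow> ('a \<Rightarrow> real) \<Rightarrow> bool" where
  "test_function \<Omega> \<phi> \<longleftrightarrow> smooth_on \<phi> UNIV \<and>
     compact (closure {x. \<phi> x \<noteq> 0}) \<and> closure {x. \<phi> x \<noteq> 0} \<subseteq> \<Omega>"


section \<open>Admissible domains\<close>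

text \<open>Near each boundary point \<open>p\<close>, in Cartesian coordinates \<open>x = p + T y\<close> obtained by a rigid motion,
  the set is the part below the graph of a Lipschitz function.\<close>

definition lipschitz_boundary :: "('a::euclidean_space \<times> real) set \<Rightarrow> bool" where
  "lipschitz_boundary \<Omega> \<longleftrightarrow>
     (\<forall>p\<in>frontier \<Omega>. \<exists>U T \<gamma> C. open U \<and> p \<in> U \<and> orthogonal_transformation T \<and>
        C-lipschitz_on UNIV \<gamma> \<and>
        (\<forall>y :: 'a \<times> real. p + T y \<in> U \<longrightarrow> (p + T y \<in> \<Omega> \<longleftrightarrow> snd y < \<gamma> (fst y))))"

definition smooth_hypersurface :: "'a::euclidean_space set \<Rightarrow> bool" where
  "smooth_hypersurface S \<longleftrightarrow>
     (\<forall>p\<in>S. \<exists>U \<phi>. open U \<and> p \<in> U \<and> smooth_on \<phi> U \<and> (\<forall>x\<in>U. grad \<phi> x \<noteq> 0) \<and>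
        S \<inter> U = {x \<in> U. \<phi> x = 0})"

text \<open>Vanishing of the \<open>(n - 1)\<close>-dimensional Hausdorff measure, \<open>n = DIM('a)\<close>, expressed through covers
  by countably many balls. The radii need not be small: for positive dimension the null sets of
  Hausdorff measure and of Hausdorff content coincide.\<close>

definition hypersurface_null :: "'a::euclidean_space set \<Rightarrow> bool" where
  "hypersurface_null N \<longleftrightarrow>
     (\<forall>\<epsilon>>0. \<exists>c r. N \<subseteq> (\<Union>i::nat. cball (c i) (r i)) \<and> (\<forall>i. 0 \<le> r i) \<and>
        summable (\<lambda>i. r i ^ (DIM('a) - 1)) \<and> (\<Sum>i. r i ^ (DIM('a) - 1)) < (\<epsilon>::real))"

text \<open>Finitely many disjoint smooth pieces make up all of \<open>\<Gamma>\<close> except for edges, corners etc.\<close>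

definition piecewise_smooth :: "'a::euclidean_space set \<Rightarrow> bool" where
  "piecewise_smooth \<Gamma> \<longleftrightarrow>
     (\<exists>P. finite P \<and> pairwise disjnt P \<and>
        (\<forall>S\<in>P. openin (top_of_set \<Gamma>) S \<and> connected S \<and> smooth_hypersurface S) \<and>
        hypersurface_null (\<Gamma> - \<Union>P))"

definition admissible_domain ::
    "('a::euclidean_space \<times> real) set \<Rightarrow> 'a set \<Rightarrow> ('a \<times> real) set \<Rightarrow> bool" where
  "admissible_domain \<Omega> F B \<longleftrightarrow>
     open \<Omega> \<and> connected \<Omega> \<and> \<Omega> \<noteq> {} \<and> bounded \<Omega> \<and>
     lipschitz_boundary \<Omega> \<and> piecewise_smooth (frontier \<Omega>) \<and>
     frontier \<Omega> = F \<times> {0} \<union> B \<and> B \<subseteq> {x. snd x < 0} \<and>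
     measure lebesgue F > 0"

definition john_condition :: "('a::euclidean_space \<times> real) set \<Rightarrow> 'a set \<Rightarrow> bool" where
  "john_condition \<Omega> F \<longleftrightarrow> \<Omega> \<subseteq> F \<times> {..<0}"


section \<open>The Sobolev space \<open>H\<^sup>1\<close> and traces on the free surface\<close>

definition L2_on :: "'a::euclidean_space set \<Rightarrow> ('a \<Rightarrow> 'b::euclidean_space) \<Rightarrow> bool" where
  "L2_on S f \<longleftrightarrow> f \<in> borel_measurable (lebesgue_on S) \<and>
     integrable (lebesgue_on S) (\<lambda>x. (norm (f x))\<^sup>2)"

definition sq_norm_L2 :: "'a::euclidean_space set \<Rightarrow> ('a \<Rightarrow> 'b::euclidean_space) \<Rightarrow> ennreal" where
  "sq_norm_L2 S f = (\<integral>\<^sup>+ x. ennreal ((norm (f x))\<^sup>2) \<partial>lebesgue_on S)"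

text \<open>\<open>u\<close> belongs to \<open>H\<^sup>1(\<Omega>)\<close>, and \<open>G\<close> is its weak gradient.\<close>

definition H1_gradient ::
    "'a::euclidean_space set \<Rightarrow> ('a \<Rightarrow> real) \<Rightarrow> ('a \<Rightarrow> 'a) \<Rightarrow> bool" where
  "H1_gradient \<Omega> u G \<longleftrightarrow> L2_on \<Omega> u \<and> L2_on \<Omega> G \<and>
     (\<forall>\<phi>. test_function \<Omega> \<phi> \<longrightarrow>
        (\<integral>x. u x *\<^sub>R grad \<phi> x \<partial>lebesgue_on \<Omega>) = - (\<integral>x. \<phi> x *\<^sub>R G x \<partial>lebesgue_on \<Omega>))"

text \<open>\<open>g\<close> is the trace on \<open>F\<close> of \<open>u \<in> H\<^sup>1(\<Omega>)\<close> with weak gradient \<open>G\<close>: the trace operator is the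
  continuous extension to \<open>H\<^sup>1(\<Omega>)\<close> of the restriction map on functions that are smooth up to the
  boundary. For a bounded Lipschitz domain every \<open>u \<in> H\<^sup>1(\<Omega>)\<close> has a trace, and it is unique up to
  null sets.\<close>

definition H1_trace ::
    "('a::euclidean_space \<times> real) set \<Rightarrow> 'a set \<Rightarrow> ('a \<times> real \<Rightarrow> real) \<Rightarrow>
       ('a \<times> real \<Rightarrow> 'a \<times> real) \<Rightarrow> ('a \<Rightarrow> real) \<Rightarrow> bool" where
  "H1_trace \<Omega> F u G g \<longleftrightarrow> L2_on F g \<and>
     (\<exists>\<phi>. (\<forall>m::nat. smooth_on (\<phi> m) UNIV) \<and>
        (\<lambda>m. sq_norm_L2 \<Omega> (\<lambda>x. \<phi> m x - u x)) \<longlonglongrightarrow> 0 \<and>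
        (\<lambda>m. sq_norm_L2 \<Omega> (\<lambda>x. grad (\<phi> m) x - G x)) \<longlonglongrightarrow> 0 \<and>
        (\<lambda>m. sq_norm_L2 F (\<lambda>y. \<phi> m (y, 0) - g y)) \<longlonglongrightarrow> 0)"


section \<open>Sloshing eigenvalues\<close>

text \<open>The Rayleigh quotient of a function with gradient \<open>G\<close> and trace \<open>g\<close>; it is infinite when the
  trace vanishes.\<close>

definition rayleigh ::
    "('a::euclidean_space \<times> real) set \<Rightarrow> 'a set \<Rightarrow> ('a \<times> real \<Rightarrow> 'a \<times> real) \<Rightarrow> ('a \<Rightarrow> real) \<Rightarrow> ennreal"
  where
  "rayleigh \<Omega> F G g =
     (if sq_norm_L2 F g = 0 then \<infinity> else sq_norm_L2 \<Omega> G / sq_norm_L2 F g)"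

text \<open>The min-max formula \<open>\<nu>\<^sub>k = inf\<^sub>V sup\<^sub>f R(f)\<close>, where \<open>V\<close> ranges over the \<open>k\<close>-dimensional subspaces of
  \<open>H\<^sup>1(\<Omega>)\<close> and \<open>f\<close> over \<open>V - {0}\<close>. The space \<open>V\<close> is given by a spanning family \<open>u\<^sub>0, \<dots>, u\<^sub>k\<^sub>-\<^sub>1\<close> with
  gradients \<open>G\<^sub>i\<close> and traces \<open>g\<^sub>i\<close>. Linear independence need not be demanded: for a dependent family some
  nontrivial combination vanishes, so that its quotient, and hence the supremum, is infinite.\<close>

definition sloshing_minmax ::
    "('a::euclidean_space \<times> real) set \<Rightarrow> 'a set \<Rightarrow> nat \<Rightarrow> ennreal" where
  "sloshing_minmax \<Omega> F k =
     (INF (u, G, g) \<in> {(u, G, g). \<forall>i<k. H1_gradient \<Omega> (u i) (G i) \<and> H1_trace \<Omega> F (u i) (G i) (g i)}.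
        SUP c \<in> {c :: nat \<Rightarrow> real. \<exists>i<k. c i \<noteq> 0}.
          rayleigh \<Omega> F (\<lambda>x. \<Sum>i<k. c i *\<^sub>R G i x) (\<lambda>y. \<Sum>i<k. c i * g i y))"

text \<open>The numbering starts at \<open>\<nu>\<^sub>1 = 0\<close>. The min-max values of an admissible domain are finite, so
  \<open>enn2real\<close> loses nothing.\<close>

definition sloshing_eigenvalue ::
    "('a::euclidean_space \<times> real) set \<Rightarrow> 'a set \<Rightarrow> nat \<Rightarrow> real" where
  "sloshing_eigenvalue \<Omega> F k = enn2real (sloshing_minmax \<Omega> F k)"

definition weyl_term :: "nat \<Rightarrow> nat \<Rightarrow> real \<Rightarrow> real" where
  "weyl_term n k A =
     2 * pi * unit_ball_vol (real n - 1) powr (- 1 / (real n - 1)) * (real k / A) powr (1 / (real n - 1))"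

end

theory Submission
  imports Defs
begin

text \<open>
  The trial functions \<open>wave p\<close>, \<open>p \<in> (2\<pi>/L) \<int>\<^sup>d\<close> with \<open>d = n - 1\<close>, are harmonic and decay with depth; on
  \<open>x\<^sub>n = 0\<close> they are \<open>cos (p \<bullet> y) + sin (p \<bullet> y)\<close>, a real orthogonal system in \<open>L\<^sup>2\<close> of a cube of side \<open>L\<close>
  that contains \<open>\<F>\<close>. Let \<open>a\<close> and \<open>b\<close> be the matrices of \<open>\<integral>\<^sub>\<Omega> |\<nabla>f|\<^sup>2\<close> and \<open>\<integral>\<^sub>\<F> |f|\<^sup>2\<close> on the span of the
  waves with \<open>|p| < z\<close>, where \<open>z \<le> \<nu>\<^sub>k\<^sub>+\<^sub>1\<close>. By Bessel's inequality \<open>b \<le> L\<^sup>d\<close>, so the min-max formula shows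
  that the \<open>i\<close>-th largest positive eigenvalue of \<open>z b - a\<close> is at most \<open>L\<^sup>d (z - \<nu>\<^sub>i)\<close>, and that there are
  at most \<open>k\<close> of them. The John condition gives \<open>a\<^sub>p\<^sub>p \<le> |p| |\<F>|\<close>, and comparing traces yields
  \<open>|\<F>| \<Sum>\<^sub>p (z - |p|)\<^sub>+ \<le> L\<^sup>d \<Sum>\<^sub>i\<^sub>\<le>\<^sub>k (z - min z \<nu>\<^sub>i)\<close>. As \<open>L \<rightarrow> \<infinity>\<close> the left side, divided by \<open>L\<^sup>d\<close>, tends to
  a multiple of \<open>z\<^bsup>d+1\<^esup>\<close>; for \<open>z = \<nu>\<^sub>k\<^sub>+\<^sub>1\<close>, Bernoulli's inequality bounds this power below by a
  quadratic polynomial.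
\<close>

section \<open>Positive eigenvalues of symmetric matrices\<close>

definition qform :: "'i set \<Rightarrow> ('i \<Rightarrow> 'i \<Rightarrow> real) \<Rightarrow> ('i \<Rightarrow> real) \<Rightarrow> real" where
  "qform I M c = (\<Sum>x\<in>I. \<Sum>y\<in>I. M x y * c x * c y)"

lemma compact_PiE_UNIV:
  fixes S :: "'i \<Rightarrow> 'b::topological_space set"
  assumes "\<And>i. compact (S i)"
  shows "compact (PiE UNIV S)"
proof -
  have "compactin (product_topology (\<lambda>_. euclidean) UNIV) (PiE UNIV S)"
    using assms by (simp add: compactin_PiE)
  then show ?thesis
    by (simp add: euclidean_product_topology)
qed

text \<open>Compactness of the unit sphere gives the maximizer, and homogeneity of degree two
  carries the bound from the sphere to every \<open>c\<close>.\<close>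

lemma qform_attains_max:
  assumes fin: "finite I" and ne: "I \<noteq> {}"
  obtains e l where "(\<Sum>x\<in>I. (e x)\<^sup>2) = 1" "qform I M e = l"
    "\<And>c. qform I M c \<le> l * (\<Sum>x\<in>I. (c x)\<^sup>2)"
proof -
  \<comment> \<open>Vectors are total functions, so the entries off \<open>I\<close> are pinned to
    0. Those in \<open>I\<close> lie in [-1, 1] on the sphere anyway; stating it exhibits
    \<open>S\<close> as a closed part of a product of compact sets.\<close>
  define S where "S = PiE UNIV (\<lambda>x. if x \<in> I then {-1..1::real} else {0}) \<inter> {c. (\<Sum>x\<in>I. (c x)\<^sup>2) = 1}"
  have "compact S"
    unfolding S_def
    by (intro compact_Int_closed compact_PiE_UNIV closed_Collect_eq continuous_intros
          continuous_on_product_coordinates) auto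
  moreover obtain x0 where x0: "x0 \<in> I" using ne by blast
  have "(\<Sum>x\<in>I. (if x = x0 then 1 else 0 :: real)\<^sup>2) = 1"
    using fin x0 by (simp add: if_distrib[of "\<lambda>z. z\<^sup>2"] cong: if_cong)
  then have "(\<lambda>x. if x = x0 then 1 else 0) \<in> S"
    using x0 by (auto simp: S_def)
  then have "S \<noteq> {}" by fastforce
  moreover have "continuous_on S (qform I M)"
    unfolding qform_def
    by (intro continuous_intros continuous_on_subset[OF continuous_on_product_coordinates]) auto
  ultimately have "\<exists>e\<in>S. \<forall>c\<in>S. qform I M c \<le> qform I M e"
    by (rule continuous_attains_sup)
  then obtain e where e: "e \<in> S" "\<And>c. c \<in> S \<Longrightarrow> qform I M c \<le> qform I M e"
    by auto
  show thesis
  proof (rule that[of e "qform I M e"])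
    show "(\<Sum>x\<in>I. (e x)\<^sup>2) = 1" using e by (auto simp: S_def)
    fix c :: "'a \<Rightarrow> real"
    define N where "N = (\<Sum>x\<in>I. (c x)\<^sup>2)"
    show "qform I M c \<le> qform I M e * (\<Sum>x\<in>I. (c x)\<^sup>2)"
    proof (cases "N = 0")
      case True
      then have "\<And>x. x \<in> I \<Longrightarrow> c x = 0"
        using fin by (simp add: N_def sum_nonneg_eq_0_iff)
      then have "qform I M c = 0" by (simp add: qform_def)
      with True show ?thesis by (simp add: N_def)
    next
      case False
      then have N: "N > 0" unfolding N_def by (simp add: order_less_le sum_nonneg)
      define c' where "c' x = (if x \<in> I then c x / sqrt N else 0)" for x
      have sq: "(c' x)\<^sup>2 = (c x)\<^sup>2 / N" if "x \<in> I" for x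
        using N that by (simp add: c'_def power_divide)
      have 1: "(\<Sum>x\<in>I. (c' x)\<^sup>2) = 1"
        using N by (simp add: sq N_def sum_divide_distrib[symmetric])
      have "\<bar>c' x\<bar> \<le> 1" if "x \<in> I" for x
      proof -
        have "(c' x)\<^sup>2 \<le> (\<Sum>x\<in>I. (c' x)\<^sup>2)"
          by (rule member_le_sum[OF that]) (use fin in auto)
        then show ?thesis using 1 by (simp add: abs_square_le_1)
      qed
      then have "-1 \<le> c' x \<and> c' x \<le> 1" if "x \<in> I" for x
        using that by (metis abs_le_iff minus_le_iff)
      then have "c' x \<in> (if x \<in> I then {-1..1} else {0})" for x
        by (cases "x \<in> I") (auto simp: c'_def)
      then have "c' \<in> S" using 1 by (simp add: S_def PiE_UNIV_domain)
      then have le: "qform I M c' \<le> qform I M e" by (rule e)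
      have "M x y * c' x * c' y = M x y * c x * c y / N" if "x \<in> I" "y \<in> I" for x y
        using N that by (simp add: c'_def field_simps)
      then have "qform I M c' = qform I M c / N"
        by (simp add: qform_def sum_divide_distrib)
      with le N show ?thesis by (simp add: N_def[symmetric] field_simps)
    qed
  qed simp
qed

lemma quadratic_dominates_linear_imp_zero:
  assumes "\<And>t::real. 2 * t * a \<le> t\<^sup>2 * b"
  shows "a = 0"
proof (rule ccontr)
  assume a: "a \<noteq> 0"
  \<comment> \<open>With this \<open>t\<close> the quadratic term is at most \<open>a * t\<close>,
    which is strictly less than the linear term \<open>2 * t * a\<close>.\<close>
  define t where "t = a / (\<bar>b\<bar> + 1)"
  have b: "\<bar>b\<bar> + 1 > 0" by simp
  have "a * a > 0" using a by (simp add: zero_less_mult_iff) linarith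
  then have t: "a * t > 0" using divide_pos_pos[OF _ b] by (simp add: t_def)
  have ta: "t * (\<bar>b\<bar> + 1) = a" using b by (simp add: t_def)
  have "t\<^sup>2 * b \<le> t\<^sup>2 * (\<bar>b\<bar> + 1)" by (rule mult_left_mono) auto
  also have "\<dots> = t * (t * (\<bar>b\<bar> + 1))" by (simp add: power2_eq_square mult.assoc)
  also have "\<dots> = a * t" unfolding ta by (simp add: mult.commute)
  finally have "t\<^sup>2 * b \<le> a * t" .
  then show False using assms[of t] t by (simp add: algebra_simps)
qed

text \<open>Serves twice: as the first variation at a maximizer, and with \<open>e = 0\<close>,
  \<open>t = 1\<close> to read off a diagonal entry.\<close>

lemma qform_add_unit:
  assumes fin: "finite I" and sym: "\<And>x y. x \<in> I \<Longrightarrow> y \<in> I \<Longrightarrow> M x y = M y x" and x: "x \<in> I"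
  shows "qform I M (\<lambda>y. e y + t * (if y = x then 1 else 0)) =
    qform I M e + 2 * t * (\<Sum>y\<in>I. M x y * e y) + t\<^sup>2 * M x x"
proof -
  let ?d = "\<lambda>y. if y = x then 1 else 0 :: real"
  have "M u v * (e u + t * ?d u) * (e v + t * ?d v) =
      M u v * e u * e v + t * (if u = x then M u v * e v else 0)
      + t * (if v = x then M u v * e u else 0) + t\<^sup>2 * (if u = x then if v = x then M u v else 0 else 0)" for u v
    by (simp add: algebra_simps power2_eq_square)
  then have "qform I M (\<lambda>y. e y + t * ?d y) =
    qform I M e + t * (\<Sum>u\<in>I. \<Sum>v\<in>I. if u = x then M u v * e v else 0)
      + t * (\<Sum>u\<in>I. \<Sum>v\<in>I. if v = x then M u v * e u else 0)
      + t\<^sup>2 * (\<Sum>u\<in>I. \<Sum>v\<in>I. if u = x then if v = x then M u v else 0 else 0)"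
    by (simp add: qform_def sum.distrib sum_distrib_left)
  also have "(\<Sum>u\<in>I. \<Sum>v\<in>I. if u = x then M u v * e v else 0) = (\<Sum>v\<in>I. M x v * e v)"
    by (subst sum.swap) (use fin x in simp)
  also have "(\<Sum>u\<in>I. \<Sum>v\<in>I. if v = x then M u v * e u else 0) = (\<Sum>v\<in>I. M x v * e v)"
    using fin x sym by (simp cong: sum.cong)
  also have "(\<Sum>u\<in>I. \<Sum>v\<in>I. if u = x then if v = x then M u v else 0 else 0) = M x x"
    by (subst sum.swap) (use fin x in simp)
  finally show ?thesis by simp
qed

text \<open>First variation: perturbing the maximizer in one coordinate by \<open>t\<close> cannot
  beat the bound, so the coefficient linear in \<open>t\<close> vanishes, which is one row of the
  eigenvalue equation.\<close>

lemma qform_maximizer_eigenvector: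
  assumes fin: "finite I" and sym: "\<And>x y. x \<in> I \<Longrightarrow> y \<in> I \<Longrightarrow> M x y = M y x"
    and e: "(\<Sum>x\<in>I. (e x)\<^sup>2) = 1" "qform I M e = l"
    and max: "\<And>c. qform I M c \<le> l * (\<Sum>x\<in>I. (c x)\<^sup>2)"
    and x: "x \<in> I"
  shows "(\<Sum>y\<in>I. M x y * e y) = l * e x"
proof -
  have "2 * t * ((\<Sum>y\<in>I. M x y * e y) - l * e x) \<le> t\<^sup>2 * (l - M x x)" for t
  proof -
    let ?d = "\<lambda>y. if y = x then 1 else 0 :: real"
    have "(e y + t * ?d y)\<^sup>2 = (e y)\<^sup>2 + (if y = x then 2 * t * e y + t\<^sup>2 else 0)" for y
      by (simp add: algebra_simps power2_eq_square)
    then have "(\<Sum>y\<in>I. (e y + t * ?d y)\<^sup>2) = 1 + 2 * t * e x + t\<^sup>2"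
      using fin x e by (simp add: sum.distrib)
    then have "qform I M e + 2 * t * (\<Sum>y\<in>I. M x y * e y) + t\<^sup>2 * M x x \<le> l * (1 + 2 * t * e x + t\<^sup>2)"
      using max[of "\<lambda>y. e y + t * ?d y"] qform_add_unit[OF fin sym x, where e = e and t = t] by simp
    then show ?thesis using e(2) by (simp add: algebra_simps)
  qed
  from quadratic_dominates_linear_imp_zero[OF this] show ?thesis by simp
qed

lemma qform_eq_sum_eigen:
  assumes "\<And>x. x \<in> I \<Longrightarrow> (\<Sum>y\<in>I. M x y * c y) = v x"
  shows "qform I M c = (\<Sum>x\<in>I. v x * c x)"
proof -
  have "qform I M c = (\<Sum>x\<in>I. c x * (\<Sum>y\<in>I. M x y * c y))"
    by (simp add: qform_def sum_distrib_left mult_ac)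
  then show ?thesis using assms by (simp add: mult_ac)
qed

text \<open>A partial system: the vectors need not span, and zero or negative eigenvalues are left
  out.\<close>

definition eigensystem ::
    "'i set \<Rightarrow> ('i \<Rightarrow> 'i \<Rightarrow> real) \<Rightarrow> nat \<Rightarrow> (nat \<Rightarrow> 'i \<Rightarrow> real) \<Rightarrow> (nat \<Rightarrow> real) \<Rightarrow> bool" where
  "eigensystem I M s e l \<longleftrightarrow>
    (\<forall>i<s. \<forall>j<s. (\<Sum>x\<in>I. e i x * e j x) = (if i = j then 1 else 0)) \<and>
    (\<forall>i<s. \<forall>x\<in>I. (\<Sum>y\<in>I. M x y * e i y) = l i * e i x) \<and>
    (\<forall>i<s. 0 < l i) \<and> (\<forall>j<s. \<forall>i\<le>j. l j \<le> l i)"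

text \<open>Induction on \<open>N\<close>, peeling off the largest eigenvalue while it is positive.
  If the process stops before \<open>N\<close> steps, the remaining form is nonpositive and so is
  its trace; adding back the removed eigenvalues bounds the trace of \<open>M\<close>.\<close>

lemma positive_spectral_truncation:
  fixes M :: "'i \<Rightarrow> 'i \<Rightarrow> real" and N :: nat
  assumes fin: "finite I" and sym: "\<And>x y. x \<in> I \<Longrightarrow> y \<in> I \<Longrightarrow> M x y = M y x"
  shows "\<exists>s\<le>N. \<exists>e l. eigensystem I M s e l \<and> (s < N \<longrightarrow> (\<Sum>x\<in>I. M x x) \<le> (\<Sum>i<s. l i))"
  using sym
proof (induction N arbitrary: M)
  case 0
  then show ?case by (auto simp: eigensystem_def)
next
  case (Suc N)
  show ?case
  proof (cases "\<forall>c. qform I M c \<le> 0")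
    case True
    have "M x x \<le> 0" if "x \<in> I" for x
      \<comment> \<open>Evaluating the form at a unit vector, written in the shape of
        \<open>qform_add_unit\<close>, gives \<open>M x x\<close>.\<close>
      using True[rule_format, of "\<lambda>y. 0 + 1 * (if y = x then 1 else 0)"] fin
      by (subst (asm) qform_add_unit[OF fin Suc.prems that]) (simp_all add: qform_def)
    then have "(\<Sum>x\<in>I. M x x) \<le> 0" by (simp add: sum_nonpos)
    then show ?thesis by (intro exI[of _ 0]) (auto simp: eigensystem_def)
  next
    case False
    then obtain c where c: "qform I M c > 0" by (auto simp: not_le)
    then have "I \<noteq> {}" by (auto simp: qform_def)
    then obtain e l where e: "(\<Sum>x\<in>I. (e x)\<^sup>2) = 1" "qform I M e = l"
      and max: "\<And>c. qform I M c \<le> l * (\<Sum>x\<in>I. (c x)\<^sup>2)"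
      using qform_attains_max[OF fin] by metis
    have "0 < l * (\<Sum>x\<in>I. (c x)\<^sup>2)" using c max[of c] by linarith
    moreover have "(\<Sum>x\<in>I. (c x)\<^sup>2) \<ge> 0" by (simp add: sum_nonneg)
    ultimately have l: "l > 0" by (meson mult_nonpos_nonneg not_le)
    have eig: "(\<Sum>y\<in>I. M x y * e y) = l * e x" if "x \<in> I" for x
      by (rule qform_maximizer_eigenvector[OF fin Suc.prems e max that])
    \<comment> \<open>Deflation: eigenvectors of \<open>M'\<close> for positive eigenvalues are orthogonal to \<open>e\<close>, as \<open>M' e = 0\<close>.\<close>
    define M' where "M' x y = M x y - l * e x * e y" for x y
    have M'_app: "(\<Sum>y\<in>I. M' x y * c y) = (\<Sum>y\<in>I. M x y * c y) - l * e x * (\<Sum>y\<in>I. e y * c y)" for x c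
        by (simp add: M'_def algebra_simps sum_subtractf sum_distrib_left)
    have M'sym: "M' x y = M' y x" if "x \<in> I" "y \<in> I" for x y
      using Suc.prems[OF that] by (simp add: M'_def)
    obtain s f m where s: "s \<le> N" and sys: "eigensystem I M' s f m"
      and tr: "s < N \<Longrightarrow> (\<Sum>x\<in>I. M' x x) \<le> (\<Sum>i<s. m i)"
      using Suc.IH[of M', OF M'sym] by blast
    have on: "(\<Sum>x\<in>I. f i x * f j x) = (if i = j then 1 else 0)" if "i < s" "j < s" for i j
      using sys that by (simp add: eigensystem_def)
    have eigf: "(\<Sum>y\<in>I. M' x y * f i y) = m i * f i x" if "i < s" "x \<in> I" for i x
      using sys that by (simp add: eigensystem_def)
    have pos: "0 < m i" if "i < s" for i
      using sys that by (simp add: eigensystem_def)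
    have anti: "m j \<le> m i" if "j < s" "i \<le> j" for i j
      using sys that by (simp add: eigensystem_def)
    have perp: "(\<Sum>x\<in>I. e x * f i x) = 0" if "i < s" for i
    proof -
      have "m i * (\<Sum>x\<in>I. e x * f i x) = (\<Sum>x\<in>I. e x * (\<Sum>y\<in>I. M' x y * f i y))"
        using that by (simp add: eigf sum_distrib_left mult_ac)
      also have "\<dots> = (\<Sum>x\<in>I. \<Sum>y\<in>I. M' y x * e x * f i y)"
        using M'sym by (simp add: sum_distrib_left mult_ac)
      also have "\<dots> = (\<Sum>y\<in>I. f i y * (\<Sum>x\<in>I. M' y x * e x))"
        by (subst sum.swap) (simp add: sum_distrib_left mult_ac)
      also have "\<dots> = 0"
      proof -
        have "(\<Sum>y\<in>I. e y * e y) = 1" using e(1) by (simp add: power2_eq_square)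
        then show ?thesis by (simp add: M'_app eig)
      qed
      finally show ?thesis using pos[OF that] by simp
    qed
    have eigf': "(\<Sum>y\<in>I. M x y * f i y) = m i * f i x" if "i < s" "x \<in> I" for i x
      using eigf[OF that] that by (simp add: M'_app perp)
    \<comment> \<open>\<open>M\<close> and \<open>M'\<close> agree on \<open>f i\<close>, so the
      form of \<open>M\<close> takes the value \<open>m i\<close> at this unit vector; maximality of
      \<open>l\<close> then keeps the list ordered when \<open>l\<close> is put in front.\<close>
    have ml: "m i \<le> l" if "i < s" for i
    proof -
      have "qform I M (f i) = (\<Sum>x\<in>I. m i * f i x * f i x)"
        by (rule qform_eq_sum_eigen) (use eigf' that in auto)
      also have "\<dots> = m i" using on[OF that that] by (simp add: sum_distrib_left[symmetric] mult.assoc)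
      finally show ?thesis using max[of "f i"] on[OF that that] by (simp add: power2_eq_square)
    qed
    define f' m' where "f' = case_nat e f" and "m' = case_nat l m"
    have "(\<Sum>x\<in>I. M' x x) = (\<Sum>x\<in>I. M x x) - l"
      using e(1) by (simp add: M'_def sum_subtractf mult.assoc sum_distrib_left[symmetric] flip: power2_eq_square)
    then have "Suc s < Suc N \<longrightarrow> (\<Sum>x\<in>I. M x x) \<le> (\<Sum>i<Suc s. m' i)"
      using tr by (auto simp: m'_def sum.lessThan_Suc_shift simp del: sum.lessThan_Suc)
    moreover have "(\<Sum>x\<in>I. f' i x * f' j x) = (if i = j then 1 else 0)" if "i < Suc s" "j < Suc s" for i j
      using that on perp e(1) by (cases i; cases j) (auto simp: f'_def power2_eq_square mult.commute)
    moreover have "(\<Sum>y\<in>I. M x y * f' i y) = m' i * f' i x" if "i < Suc s" "x \<in> I" for i x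
      using that eig eigf' by (cases i) (auto simp: f'_def m'_def)
    moreover have "0 < m' i" if "i < Suc s" for i
      using that pos l by (cases i) (auto simp: m'_def)
    moreover have "m' j \<le> m' i" if "j < Suc s" "i \<le> j" for i j
      using that anti ml by (cases i; cases j) (auto simp: m'_def)
    ultimately have "eigensystem I M (Suc s) f' m'"
      "Suc s < Suc N \<longrightarrow> (\<Sum>x\<in>I. M x x) \<le> (\<Sum>i<Suc s. m' i)"
      by (simp_all only: eigensystem_def) auto
    then show ?thesis using s by blast
  qed
qed

section \<open>Smooth functions in the Sobolev space\<close>

lemma integral_lborel_translation:
  fixes f :: "'b::euclidean_space \<Rightarrow> real"
  assumes "f \<in> borel_measurable borel"
  shows "(\<integral>x. f (c + x) \<partial>lborel) = (\<integral>x. f x \<partial>lborel)"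
proof -
  have "(\<integral>x. f x \<partial>lborel) = (\<integral>x. f x \<partial>distr lborel borel ((+) c))"
    by (simp add: lborel_distr_plus)
  also have "\<dots> = (\<integral>x. f (c + x) \<partial>lborel)"
    using assms by (subst integral_distr) auto
  finally show ?thesis by simp
qed

text \<open>Dominated convergence passes from difference quotients to the derivative. This is the
  divergence theorem without boundary term, from which integration by parts follows.\<close>

lemma integral_directional_derivative_eq_0:
  fixes w :: "'b::euclidean_space \<Rightarrow> real"
  assumes der: "\<And>x. (w has_derivative D x) (at x)"
    and cont: "continuous_on UNIV (\<lambda>x. D x v)"
    and supp: "\<And>x. norm x > R \<Longrightarrow> w x = 0"
  shows "(\<integral>x. D x v \<partial>lborel) = 0"
proof -
  \<comment> \<open>Steps have length at most \<open>norm v\<close>, so the quotients vanish outside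
    the ball of radius \<open>R'\<close>. The intermediate points of the mean value theorem stay
    within \<open>R' + norm v\<close>, where \<open>C\<close> bounds the derivative.\<close>
  define R' where "R' = R + norm v"
  define h where "h n = 1 / real (Suc n)" for n
  have h: "0 < h n" "h n \<le> 1" for n by (auto simp: h_def)
  \<comment> \<open>These difference quotients have integral zero by translation invariance.\<close>
  define s where "s n x = (w (h n *\<^sub>R v + x) - w x) / h n" for n x
  have wc: "continuous_on UNIV w"
    using has_derivative_continuous[OF der] by (auto intro!: continuous_at_imp_continuous_on)
  then have [measurable]: "w \<in> borel_measurable borel" by (rule borel_measurable_continuous_onI)
  have [measurable]: "(\<lambda>x. D x v) \<in> borel_measurable borel" by (rule borel_measurable_continuous_onI[OF cont])
  have line: "((\<lambda>t. w (t *\<^sub>R v + x)) has_real_derivative D (t *\<^sub>R v + x) v) (at t)" for t x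
  proof -
    have "((\<lambda>t. w (t *\<^sub>R v + x)) has_derivative (\<lambda>dt. D (t *\<^sub>R v + x) (dt *\<^sub>R v))) (at t)"
      by (rule has_derivative_compose[OF _ der]) (auto intro!: derivative_eq_intros)
    moreover have "D (t *\<^sub>R v + x) (dt *\<^sub>R v) = D (t *\<^sub>R v + x) v * dt" for dt
      using linear_scale[OF has_derivative_linear[OF der]] by simp
    ultimately show ?thesis by (simp add: has_field_derivative_def)
  qed
  have lim: "(\<lambda>n. s n x) \<longlonglongrightarrow> D x v" for x
  proof -
    have "((\<lambda>t. (w (t *\<^sub>R v + x) - w (0 *\<^sub>R v + x)) / t) \<longlongrightarrow> D x v) (at 0)"
      using line[of x 0] by (simp add: DERIV_def)
    moreover have "filterlim h (at 0) sequentially"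
    proof -
      have "h \<longlonglongrightarrow> 0" unfolding h_def by (rule LIMSEQ_Suc[OF lim_1_over_n])
      then show ?thesis using h by (auto simp: filterlim_at less_imp_neq[symmetric])
    qed
    ultimately show ?thesis
      unfolding s_def by (drule_tac filterlim_compose) auto
  qed
  obtain C where C: "\<And>x. norm x \<le> R' + norm v \<Longrightarrow> \<bar>D x v\<bar> \<le> C"
  proof -
    have "bounded ((\<lambda>x. D x v) ` cball 0 (R' + norm v))"
      by (intro compact_imp_bounded compact_continuous_image continuous_on_subset[OF cont]) auto
    then obtain C where "\<forall>x\<in>cball 0 (R' + norm v). \<bar>D x v\<bar> \<le> C" by (auto simp: bounded_iff)
    then show ?thesis by (intro that[of C]) simp
  qed
  have bound: "norm (s n x) \<le> indicator (cball 0 R') x *\<^sub>R C" for n x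
  proof (cases "norm x \<le> R'")
    case True
    have "\<exists>t>0. t < h n \<and> w (h n *\<^sub>R v + x) - w (0 *\<^sub>R v + x) = (h n - 0) * D (t *\<^sub>R v + x) v"
      using h(1)[of n] line by (intro MVT2) auto
    then obtain t where t: "0 < t" "t < h n" "s n x = D (t *\<^sub>R v + x) v"
      using h(1)[of n] by (auto simp: s_def)
    have "norm (t *\<^sub>R v) \<le> 1 * norm v"
      using t h(2)[of n] by (simp only: norm_scaleR) (intro mult_right_mono, auto)
    then have "norm (t *\<^sub>R v + x) \<le> R' + norm v"
      using norm_triangle_ineq[of "t *\<^sub>R v" x] True by linarith
    from C[OF this] show ?thesis using t True by simp
  next
    case False
    have "norm (h n *\<^sub>R v) \<le> 1 * norm v"
      using h[of n] by (simp only: norm_scaleR) (intro mult_right_mono, auto)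
    then have "norm (h n *\<^sub>R v + x) > R"
      using norm_triangle_ineq4[of "h n *\<^sub>R v + x" "h n *\<^sub>R v"] False by (simp add: R'_def)
    then have "w (h n *\<^sub>R v + x) = 0" by (rule supp)
    moreover have "R < norm x" using False norm_ge_zero[of v] unfolding R'_def by linarith
    then have "w x = 0" by (rule supp)
    ultimately show ?thesis using False by (simp add: s_def)
  qed
  have "(\<lambda>n. \<integral>x. s n x \<partial>lborel) \<longlonglongrightarrow> (\<integral>x. D x v \<partial>lborel)"
  proof (rule integral_dominated_convergence)
    show "integrable lborel (\<lambda>x. indicator (cball 0 R') x *\<^sub>R C)"
      by (rule borel_integrable_compact) auto
    show "AE x in lborel. (\<lambda>n. s n x) \<longlonglongrightarrow> D x v" using lim by simp
    show "AE x in lborel. norm (s n x) \<le> indicator (cball 0 R') x *\<^sub>R C" for n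
      using bound by simp
    show "s n \<in> borel_measurable lborel" for n unfolding s_def by measurable
  qed measurable
  moreover have "(\<integral>x. s n x \<partial>lborel) = 0" for n
  proof -
    have "integrable lborel (\<lambda>x. indicator (cball 0 R) x *\<^sub>R w x)"
      by (intro borel_integrable_compact continuous_on_subset[OF wc]) auto
    also have "(\<lambda>x. indicator (cball 0 R) x *\<^sub>R w x) = w"
      using supp by (auto simp: indicator_def fun_eq_iff not_le)
    finally have iw: "integrable lborel w" .
    have "integrable (distr lborel borel ((+) (h n *\<^sub>R v))) w"
      using iw by (simp add: lborel_distr_plus)
    then have "integrable lborel (\<lambda>x. w (h n *\<^sub>R v + x))"
      by (subst (asm) integrable_distr_eq) auto
    then show ?thesis
      using iw integral_lborel_translation[of w "h n *\<^sub>R v"] by (simp add: s_def)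
  qed
  ultimately show ?thesis by (simp add: LIMSEQ_const_iff)
qed

lemma continuous_integrable_on_bounded:
  fixes f :: "'b::euclidean_space \<Rightarrow> 'c::euclidean_space"
  assumes "bounded \<Omega>" "\<Omega> \<in> sets lebesgue" "continuous_on UNIV f"
  shows "integrable (lebesgue_on \<Omega>) f"
proof -
  have "bounded (f ` closure \<Omega>)"
    using assms by (intro compact_imp_bounded compact_continuous_image continuous_on_subset[OF assms(3)]) auto
  then obtain C where C: "\<And>x. x \<in> \<Omega> \<Longrightarrow> norm (f x) \<le> C"
    by (metis bounded_iff closure_subset image_eqI subsetD)
  interpret finite_measure "lebesgue_on \<Omega>"
    using assms by (intro finite_measure_lebesgue_on bounded_set_imp_lmeasurable)
  show ?thesis
  proof (rule integrable_const_bound)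
    show "AE x in lebesgue_on \<Omega>. norm (f x) \<le> C" using C by (intro AE_I2) simp
    show "f \<in> borel_measurable (lebesgue_on \<Omega>)"
      by (intro continuous_imp_measurable_on_sets_lebesgue continuous_on_subset[OF assms(3)] assms) auto
  qed
qed

lemma continuous_L2_on_bounded:
  fixes f :: "'b::euclidean_space \<Rightarrow> 'c::euclidean_space"
  assumes "bounded \<Omega>" "\<Omega> \<in> sets lebesgue" "continuous_on UNIV f"
  shows "L2_on \<Omega> f"
  unfolding L2_on_def
proof
  show "f \<in> borel_measurable (lebesgue_on \<Omega>)"
    by (intro continuous_imp_measurable_on_sets_lebesgue continuous_on_subset[OF assms(3)] assms) auto
  show "integrable (lebesgue_on \<Omega>) (\<lambda>x. (norm (f x))\<^sup>2)"
    by (intro continuous_integrable_on_bounded assms continuous_intros)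
qed

lemma smooth_on_UNIV_has_derivative:
  "smooth_on f UNIV \<Longrightarrow> (f has_derivative frechet_derivative f (at x)) (at x)"
  using frechet_derivative_works[of f "at x"]
  by (auto simp: smooth_on_def dest: spec[of _ "Suc 0"])

lemma smooth_on_UNIV_continuous: "smooth_on f UNIV \<Longrightarrow> continuous_on UNIV f"
  by (auto simp: smooth_on_def dest: spec[of _ 0])

lemma smooth_on_UNIV_continuous_derivative:
  "smooth_on f UNIV \<Longrightarrow> continuous_on UNIV (\<lambda>x. frechet_derivative f (at x) v)"
  by (auto simp: smooth_on_def dest: spec[of _ "Suc 0"])

lemma continuous_on_grad: "smooth_on f UNIV \<Longrightarrow> continuous_on UNIV (grad f)"
  unfolding grad_def[abs_def] by (intro continuous_intros smooth_on_UNIV_continuous_derivative)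

lemma grad_inner_Basis: "b \<in> Basis \<Longrightarrow> grad f x \<bullet> b = frechet_derivative f (at x) b"
  by (simp add: grad_def inner_sum_left inner_Basis if_distrib cong: if_cong)

text \<open>The product \<open>u * \<phi>\<close> has compact support in \<open>\<Omega>\<close>, so
  its partial derivatives integrate to 0; the product rule turns this into the identity defining the
  weak gradient.\<close>

lemma H1_gradient_smooth:
  assumes "open \<Omega>" "bounded \<Omega>" and u: "smooth_on u UNIV"
  shows "H1_gradient \<Omega> u (grad u)"
proof -
  have m: "\<Omega> \<in> sets lebesgue" using assms(1) by simp
  have parts: "(\<integral>x. u x *\<^sub>R grad \<phi> x \<partial>lebesgue_on \<Omega>) = - (\<integral>x. \<phi> x *\<^sub>R grad u x \<partial>lebesgue_on \<Omega>)"
    if "test_function \<Omega> \<phi>" for \<phi>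
  proof (rule euclidean_eqI)
    fix b :: 'a assume b: "b \<in> Basis"
    have \<phi>: "smooth_on \<phi> UNIV" and cK: "compact (closure {x. \<phi> x \<noteq> 0})"
      and K: "closure {x. \<phi> x \<noteq> 0} \<subseteq> \<Omega>" using that by (auto simp: test_function_def)
    note cont = continuous_on_grad[OF u] continuous_on_grad[OF \<phi>]
      smooth_on_UNIV_continuous[OF u] smooth_on_UNIV_continuous[OF \<phi>]
    note int = continuous_integrable_on_bounded[OF assms(2) m]
    define D where "D x h = u x * frechet_derivative \<phi> (at x) h + frechet_derivative u (at x) h * \<phi> x" for x h
    have D: "((\<lambda>x. u x * \<phi> x) has_derivative D x) (at x)" for x
      unfolding D_def
      by (rule has_derivative_mult[OF smooth_on_UNIV_has_derivative smooth_on_UNIV_has_derivative, OF u \<phi>])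
    have D_b: "D x b = u x * (grad \<phi> x \<bullet> b) + \<phi> x * (grad u x \<bullet> b)" for x
      by (simp add: D_def grad_inner_Basis[OF b])
    have Dc: "continuous_on UNIV (\<lambda>x. D x b)"
      unfolding D_b by (intro continuous_intros cont)
    \<comment> \<open>Needed to replace the integral over \<open>\<Omega>\<close> by one over the
      whole space: off the closed support, \<phi> is zero in a neighbourhood, so its derivative
      vanishes too.\<close>
    have out: "D x b = 0" if "x \<notin> \<Omega>" for x
    proof -
      have "x \<in> - closure {x. \<phi> x \<noteq> 0}" using that K by auto
      then have "(\<phi> has_derivative (\<lambda>_. 0)) (at x)"
        using closure_subset[of "{x. \<phi> x \<noteq> 0}"]
        by (intro has_derivative_transform_within_open[OF has_derivative_const[of 0], where s = "- closure {x. \<phi> x \<noteq> 0}"]) auto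
      then have "frechet_derivative \<phi> (at x) = (\<lambda>_. 0)" by (rule frechet_derivative_at[symmetric])
      moreover have "\<phi> x = 0" using that K closure_subset[of "{x. \<phi> x \<noteq> 0}"] by auto
      ultimately show ?thesis by (simp add: D_def)
    qed
    obtain R where R: "\<And>x. \<phi> x \<noteq> 0 \<Longrightarrow> norm x \<le> R"
      using compact_imp_bounded[OF cK] closure_subset[of "{x. \<phi> x \<noteq> 0}"] by (auto simp: bounded_iff)
    have "(\<integral>x. u x *\<^sub>R grad \<phi> x \<partial>lebesgue_on \<Omega>) \<bullet> b + (\<integral>x. \<phi> x *\<^sub>R grad u x \<partial>lebesgue_on \<Omega>) \<bullet> b
        = (\<integral>x. u x * (grad \<phi> x \<bullet> b) \<partial>lebesgue_on \<Omega>) + (\<integral>x. \<phi> x * (grad u x \<bullet> b) \<partial>lebesgue_on \<Omega>)"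
      by (subst (1 2) integral_inner_left[symmetric]) (auto intro!: int continuous_intros cont)
    also have "\<dots> = (\<integral>x. D x b \<partial>lebesgue_on \<Omega>)"
      unfolding D_b by (rule Bochner_Integration.integral_add[symmetric]) (intro int continuous_intros cont)+
    also have "\<dots> = (\<integral>x. (if x \<in> \<Omega> then D x b else 0) \<partial>lebesgue)"
      by (rule Lebesgue_Measure.integral_restrict_UNIV[OF m, symmetric])
    also have "(\<lambda>x. if x \<in> \<Omega> then D x b else 0) = (\<lambda>x. D x b)" using out by auto
    also have "(\<integral>x. D x b \<partial>lebesgue) = (\<integral>x. D x b \<partial>lborel)"
      using borel_measurable_continuous_onI[OF Dc] by (intro integral_completion) simp
    also have "\<dots> = 0"
      by (rule integral_directional_derivative_eq_0[OF D Dc, of R]) (metis R mult_eq_0_iff not_le)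
    finally show "(\<integral>x. u x *\<^sub>R grad \<phi> x \<partial>lebesgue_on \<Omega>) \<bullet> b = (- (\<integral>x. \<phi> x *\<^sub>R grad u x \<partial>lebesgue_on \<Omega>)) \<bullet> b"
      by (simp add: inner_minus_left)
  qed
  show ?thesis
    unfolding H1_gradient_def
    by (intro conjI allI impI parts continuous_L2_on_bounded[OF assms(2) m] continuous_on_grad[OF u]
          smooth_on_UNIV_continuous[OF u])
qed

text \<open>The constant sequence \<open>u\<close> is an admissible smooth approximation.\<close>

lemma H1_trace_smooth:
  fixes u :: "'b::euclidean_space \<times> real \<Rightarrow> real"
  assumes "bounded F" "F \<in> sets lebesgue" and u: "smooth_on u UNIV"
  shows "H1_trace \<Omega> F u (grad u) (\<lambda>y. u (y, 0))"
  unfolding H1_trace_def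
proof
  show "L2_on F (\<lambda>y. u (y, 0))"
    by (intro continuous_L2_on_bounded assms continuous_on_compose2[OF smooth_on_UNIV_continuous[OF u]]
          continuous_intros) auto
  show "\<exists>\<phi>. (\<forall>m::nat. smooth_on (\<phi> m) UNIV) \<and>
        (\<lambda>m. sq_norm_L2 \<Omega> (\<lambda>x. \<phi> m x - u x)) \<longlonglongrightarrow> 0 \<and>
        (\<lambda>m. sq_norm_L2 \<Omega> (\<lambda>x. grad (\<phi> m) x - grad u x)) \<longlonglongrightarrow> 0 \<and>
        (\<lambda>m. sq_norm_L2 F (\<lambda>y. \<phi> m (y, 0) - u (y, 0))) \<longlonglongrightarrow> 0"
    using u by (intro exI[of _ "\<lambda>_. u"]) (simp add: sq_norm_L2_def)
qed

section \<open>Exponentially decaying waves\<close>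

text \<open>A real substitute for the complex exponential. For nonzero \<open>p\<close> the vectors
  \<open>p\<close> and \<open>- p\<close> give the different surface functions cos + sin and cos -
  sin, so there is one real function for each lattice vector.\<close>

definition wave :: "'a::euclidean_space \<Rightarrow> 'a \<times> real \<Rightarrow> real" where
  "wave p x = exp (norm p * snd x) * (cos (p \<bullet> fst x) + sin (p \<bullet> fst x))"

definition wave_grad :: "'a::euclidean_space \<Rightarrow> 'a \<times> real \<Rightarrow> 'a \<times> real" where
  "wave_grad p x = exp (norm p * snd x) *\<^sub>R
     ((cos (p \<bullet> fst x) - sin (p \<bullet> fst x)) *\<^sub>R p, norm p * (cos (p \<bullet> fst x) + sin (p \<bullet> fst x)))"

text \<open>These sums are closed under differentiation, which makes smoothness a plain induction.\<close>

lemma has_derivative_trig_exp_sum: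
  fixes l m :: "'i \<Rightarrow> 'b::euclidean_space"
  shows "((\<lambda>x. \<Sum>p\<in>P. exp (l p \<bullet> x) * (\<alpha> p * cos (m p \<bullet> x) + \<beta> p * sin (m p \<bullet> x)))
     has_derivative (\<lambda>v. \<Sum>p\<in>P. exp (l p \<bullet> x) *
        ((\<alpha> p * (l p \<bullet> v) + \<beta> p * (m p \<bullet> v)) * cos (m p \<bullet> x) +
         (\<beta> p * (l p \<bullet> v) - \<alpha> p * (m p \<bullet> v)) * sin (m p \<bullet> x)))) (at x)"
  by (rule has_derivative_sum) (auto intro!: derivative_eq_intros ext simp: algebra_simps)

lemma Ck_on_trig_exp_sum:
  fixes l m :: "'i \<Rightarrow> 'b::euclidean_space"
  shows "Ck_on k (\<lambda>x. \<Sum>p\<in>P. exp (l p \<bullet> x) * (\<alpha> p * cos (m p \<bullet> x) + \<beta> p * sin (m p \<bullet> x))) UNIV"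
proof (induction k arbitrary: \<alpha> \<beta>)
  case 0
  show ?case by (simp add: continuous_intros)
next
  case (Suc k)
  show ?case
    using Suc.IH has_derivative_trig_exp_sum[of l \<alpha> m \<beta> P]
    by (auto simp: differentiable_def frechet_derivative_at[OF has_derivative_trig_exp_sum, symmetric])
qed

lemma wave_sum_eq:
  "(\<Sum>p\<in>P. c p * wave p x) =
   (\<Sum>p\<in>P. exp ((0, norm p) \<bullet> x) * (c p * cos ((p, 0) \<bullet> x) + c p * sin ((p, 0) \<bullet> x)))"
  by (rule sum.cong) (auto simp: wave_def inner_prod_def algebra_simps)

lemma smooth_on_wave_sum: "smooth_on (\<lambda>x. \<Sum>p\<in>P. c p * wave p x) UNIV"
  unfolding smooth_on_def wave_sum_eq by (intro allI Ck_on_trig_exp_sum)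

lemma grad_wave_sum: "grad (\<lambda>x. \<Sum>p\<in>P. c p * wave p x) x = (\<Sum>p\<in>P. c p *\<^sub>R wave_grad p x)"
proof -
  have "frechet_derivative (\<lambda>x. \<Sum>p\<in>P. c p * wave p x) (at x) v = (\<Sum>p\<in>P. c p *\<^sub>R wave_grad p x) \<bullet> v" for v
    unfolding wave_sum_eq frechet_derivative_at[OF has_derivative_trig_exp_sum, symmetric] inner_sum_left
    by (intro sum.cong) (auto simp: wave_grad_def inner_prod_def algebra_simps)
  then show ?thesis by (simp add: grad_def euclidean_representation)
qed

lemma wave_surface: "wave p (y, 0) = cos (p \<bullet> y) + sin (p \<bullet> y)"
  by (simp add: wave_def)

text \<open>The mixed terms of (cos - sin)^2 and (cos + sin)^2 cancel, so the energy density depends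
  on depth alone.\<close>

lemma norm_wave_grad: "(norm (wave_grad p x))\<^sup>2 = 2 * (norm p)\<^sup>2 * exp (2 * norm p * snd x)"
proof -
  let ?c = "cos (p \<bullet> fst x)" and ?s = "sin (p \<bullet> fst x)"
  have 1: "(norm ((?c - ?s) *\<^sub>R p, norm p * (?c + ?s)))\<^sup>2 = (?c - ?s)\<^sup>2 * (norm p)\<^sup>2 + (norm p)\<^sup>2 * (?c + ?s)\<^sup>2"
    by (simp add: norm_prod_def power_mult_distrib)
  have "(norm (wave_grad p x))\<^sup>2 = (exp (norm p * snd x))\<^sup>2 * ((?c - ?s)\<^sup>2 * (norm p)\<^sup>2 + (norm p)\<^sup>2 * (?c + ?s)\<^sup>2)"
    by (simp only: wave_grad_def norm_scaleR power_mult_distrib power2_abs real_norm_def 1)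
  also have "(?c - ?s)\<^sup>2 * (norm p)\<^sup>2 + (norm p)\<^sup>2 * (?c + ?s)\<^sup>2 = 2 * (norm p)\<^sup>2 * (?s\<^sup>2 + ?c\<^sup>2)"
    by algebra
  also have "(exp (norm p * snd x))\<^sup>2 = exp (2 * norm p * snd x)"
    by (simp add: power2_eq_square exp_add[symmetric])
  finally show ?thesis by simp
qed

lemma continuous_on_wave_grad: "continuous_on A (wave_grad p)"
  unfolding wave_grad_def[abs_def] by (intro continuous_intros)

text \<open>The John condition places \<open>\<Omega>\<close> in the column below \<open>F\<close>.
  Over each vertical line the density \<open>2 * (norm p)\<^sup>2 * exp (2 * norm p * t)\<close>
  integrates to at most \<open>norm p\<close>, and Tonelli multiplies this by the measure of
  \<open>F\<close>.\<close>

lemma wave_energy_le: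
  fixes \<Omega> :: "('a::euclidean_space \<times> real) set"
  assumes "open \<Omega>" "bounded \<Omega>" "compact F" and sub: "\<Omega> \<subseteq> F \<times> {..<0}"
  shows "(\<integral>x. (norm (wave_grad p x))\<^sup>2 \<partial>lebesgue_on \<Omega>) \<le> measure lebesgue F * norm p"
proof -
  obtain N where N: "N > 0" "\<And>x. x \<in> \<Omega> \<Longrightarrow> norm x \<le> N" using assms(2) by (auto simp: bounded_pos)
  \<comment> \<open>Boundedness of \<open>\<Omega>\<close> permits a cut at depth \<open>N\<close>,
    which leaves a compact interval for the fundamental theorem of calculus.\<close>
  define g where "g t = ennreal (2 * (norm p)\<^sup>2 * exp (2 * norm p * t)) * indicator {-N..0} t" for t
  have [measurable]: "g \<in> borel_measurable borel" unfolding g_def by measurable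
  have [measurable]: "F \<in> sets borel" using assms(3) by (simp add: borel_compact)
  have [measurable]: "\<Omega> \<in> sets borel" using assms(1) by simp
  have fm: "emeasure lborel F = ennreal (measure lebesgue F)"
  proof -
    have "measure lebesgue F = measure lborel F" by (simp add: measure_completion)
    then show ?thesis
      using emeasure_compact_finite[OF assms(3)] by (simp add: emeasure_eq_ennreal_measure)
  qed
  have int: "integrable (lebesgue_on \<Omega>) (\<lambda>x. (norm (wave_grad p x))\<^sup>2)"
    using assms(1,2) by (intro continuous_integrable_on_bounded continuous_intros continuous_on_wave_grad) auto
  have "ennreal (\<integral>x. (norm (wave_grad p x))\<^sup>2 \<partial>lebesgue_on \<Omega>)
      = (\<integral>\<^sup>+x. ennreal ((norm (wave_grad p x))\<^sup>2) \<partial>lebesgue_on \<Omega>)"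
    by (rule nn_integral_eq_integral[symmetric, OF int]) simp
  also have "\<dots> = (\<integral>\<^sup>+x. ennreal ((norm (wave_grad p x))\<^sup>2) * indicator \<Omega> x \<partial>lborel)"
    using assms(1) by (simp add: nn_integral_restrict_space nn_integral_completion)
  also have "\<dots> \<le> (\<integral>\<^sup>+x. indicator F (fst x) * g (snd x) \<partial>lborel)"
  proof (rule nn_integral_mono)
    fix x :: "'a \<times> real"
    show "ennreal ((norm (wave_grad p x))\<^sup>2) * indicator \<Omega> x \<le> indicator F (fst x) * g (snd x)"
    proof (cases "x \<in> \<Omega>")
      case True
      then have "fst x \<in> F" "snd x < 0" using sub by auto
      moreover have "- N \<le> snd x" using N(2)[OF True] norm_snd_le[of "snd x" "fst x"] by (simp add: abs_le_iff)
      ultimately show ?thesis using True by (simp add: g_def norm_wave_grad)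
    qed simp
  qed
  also have "\<dots> = (\<integral>\<^sup>+x. indicator F (fst x) * g (snd x) \<partial>(lborel \<Otimes>\<^sub>M lborel))"
    by (simp add: lborel_prod)
  also have "\<dots> = (\<integral>\<^sup>+y. \<integral>\<^sup>+t. indicator F y * g t \<partial>lborel \<partial>lborel)"
    by (subst lborel.nn_integral_fst[symmetric]) auto
  also have "\<dots> = emeasure lborel F * (\<integral>\<^sup>+t. g t \<partial>lborel)"
    by (simp add: nn_integral_cmult nn_integral_multc)
  also have "(\<integral>\<^sup>+t. g t \<partial>lborel) = ennreal (norm p * exp (2 * norm p * 0) - norm p * exp (2 * norm p * (-N)))"
    unfolding g_def
    by (rule nn_integral_FTC_Icc)
       (use N in \<open>auto intro!: derivative_eq_intros simp: power2_eq_square\<close>)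
  \<comment> \<open>The endpoint \<open>- N\<close> contributes with a minus sign and is
    dropped.\<close>
  also have "emeasure lborel F * \<dots> \<le> ennreal (measure lebesgue F * norm p)"
    unfolding fm by (subst ennreal_mult'[symmetric]) (auto intro!: mult_left_mono ennreal_leI)
  finally show ?thesis by (simp add: ennreal_le_iff)
qed

text \<open>Fubini in coordinates. Complex values are used because \<open>cis\<close> of a sum is a
  product, unlike cos and sin.\<close>

lemma integral_lborel_prod_complex:
  fixes f :: "'a::euclidean_space \<Rightarrow> real \<Rightarrow> complex"
  assumes "\<And>b. b \<in> Basis \<Longrightarrow> integrable lborel (f b)"
  shows "(\<integral>x. (\<Prod>b\<in>Basis. f b (x \<bullet> b)) \<partial>lborel) = (\<Prod>b\<in>Basis. \<integral>t. f b t \<partial>lborel)"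
proof -
  interpret product_sigma_finite "\<lambda>_::'a. lborel :: real measure" ..
  have [measurable]: "f b \<in> borel_measurable borel" if "b \<in> Basis" for b
    using assms[OF that] by (auto dest: borel_measurable_integrable)
  have "(\<integral>x. (\<Prod>b\<in>Basis. f b (x \<bullet> b)) \<partial>lborel)
      = (\<integral>x. (\<Prod>b\<in>Basis. f b ((\<Sum>c\<in>Basis. x c *\<^sub>R c) \<bullet> b)) \<partial>(\<Pi>\<^sub>M b\<in>(Basis::'a set). lborel))"
    by (subst lborel_eq, subst integral_distr) auto
  also have "\<dots> = (\<integral>x. (\<Prod>b\<in>Basis. f b (x b)) \<partial>(\<Pi>\<^sub>M b\<in>(Basis::'a set). lborel))"
    by simp
  also have "\<dots> = (\<Prod>b\<in>Basis. \<integral>t. f b t \<partial>lborel)"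
    using assms by (intro product_integral_prod) auto
  finally show ?thesis .
qed

section \<open>Orthogonality on cubes\<close>

definition lattice :: "real \<Rightarrow> 'a::euclidean_space set" where
  "lattice h = {p. \<forall>b\<in>Basis. \<exists>m::int. p \<bullet> b = h * of_int m}"

lemma lattice_add: "p \<in> lattice h \<Longrightarrow> q \<in> lattice h \<Longrightarrow> p + q \<in> lattice h"
  unfolding lattice_def
  by (auto simp: inner_add_left) (metis distrib_left of_int_add)

lemma lattice_uminus: "p \<in> lattice h \<Longrightarrow> - p \<in> lattice h"
  unfolding lattice_def
  by (auto simp: inner_minus_left) (metis mult_minus_right of_int_minus)

lemma lattice_diff: "p \<in> lattice h \<Longrightarrow> q \<in> lattice h \<Longrightarrow> p - q \<in> lattice h"
  using lattice_add[of p h "- q"] lattice_uminus[of q h] by simp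

text \<open>For \<open>r\<close> nonzero the antiderivative has period \<open>L\<close>, so its
  values at the two ends cancel.\<close>

lemma integral_cis_period:
  assumes L: "L > 0" and r: "r = 2 * pi / L * of_int m"
  shows "(\<integral>t. indicator {a..a + L} t *\<^sub>R cis (r * t) \<partial>lborel) = (if r = 0 then of_real L else 0)"
proof (cases "r = 0")
  case True
  then show ?thesis using L by (simp add: integral_indicator of_real_def)
next
  case False
  have "(\<integral>t. indicator {a..a + L} t *\<^sub>R cis (r * t) \<partial>lborel) =
      cis (r * (a + L)) / (\<i> * of_real r) - cis (r * a) / (\<i> * of_real r)"
  proof (rule integral_FTC_Icc)
    show "((\<lambda>t. cis (r * t) / (\<i> * complex_of_real r)) has_vector_derivative cis (r * t)) (at t within {a..a + L})" for t
    proof -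
      have "((\<lambda>t. exp (\<i> * of_real (r * t)) / (\<i> * complex_of_real r)) has_vector_derivative exp (\<i> * of_real (r * t))) (at t within {a..a + L})"
        using False
        by (auto intro!: derivative_eq_intros has_vector_derivative_real_field simp: field_simps)
      then show ?thesis by (simp add: cis_conv_exp)
    qed
  qed (use L in \<open>auto intro!: continuous_intros\<close>)
  also have "cis (r * (a + L)) = cis (r * a)"
  proof -
    have "r * L = 2 * pi * of_int m" using r L by simp
    then have "r * (a + L) = r * a + 2 * pi * of_int m" by (simp add: distrib_left)
    moreover have "cis (2 * pi * of_int m) = 1" by (rule cis_multiple_2pi) simp
    ultimately show ?thesis by (simp only: cis_mult[symmetric] mult_1_right)
  qed
  finally show ?thesis using False by simp
qed

text \<open>The integral factors over the coordinates, and a single nonzero coordinate of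
  \<open>r\<close> makes one factor vanish.\<close>

lemma integral_cis_cube:
  fixes a r :: "'a::euclidean_space"
  assumes L: "L > 0" and r: "r \<in> lattice (2 * pi / L)"
  shows "(\<integral>x. indicator (cbox a (a + L *\<^sub>R One)) x *\<^sub>R cis (r \<bullet> x) \<partial>lborel) =
    (if r = 0 then of_real (L ^ DIM('a)) else 0)"
proof -
  define f where "f b t = indicator {a \<bullet> b..a \<bullet> b + L} t *\<^sub>R cis ((r \<bullet> b) * t)" for b t
  have cis_sum: "cis (\<Sum>b\<in>A. g b) = (\<Prod>b\<in>A. cis (g b))" if "finite A" for A :: "'a set" and g
    using that by induction (auto simp: cis_mult[symmetric])
  have "indicator (cbox a (a + L *\<^sub>R One)) x *\<^sub>R cis (r \<bullet> x) = (\<Prod>b\<in>Basis. f b (x \<bullet> b))" for x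
  proof (cases "x \<in> cbox a (a + L *\<^sub>R One)")
    case True
    then have "f b (x \<bullet> b) = cis ((r \<bullet> b) * (x \<bullet> b))" if "b \<in> Basis" for b
      using that by (auto simp: f_def mem_box inner_add_left)
    then show ?thesis using True cis_sum[of Basis "\<lambda>b. (r \<bullet> b) * (x \<bullet> b)"]
      by (subst euclidean_inner) simp
  next
    case False
    then obtain b where b: "b \<in> Basis" "x \<bullet> b \<notin> {a \<bullet> b..a \<bullet> b + L}"
      by (auto simp: mem_box inner_add_left)
    then have "f b (x \<bullet> b) = 0" by (simp add: f_def)
    then have "(\<Prod>b\<in>Basis. f b (x \<bullet> b)) = 0" using b(1) by (intro prod_zero) auto
    then show ?thesis using False by simp
  qed
  then have "(\<integral>x. indicator (cbox a (a + L *\<^sub>R One)) x *\<^sub>R cis (r \<bullet> x) \<partial>lborel) = (\<Prod>b\<in>Basis. \<integral>t. f b t \<partial>lborel)"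
    by (simp only:, intro integral_lborel_prod_complex)
       (auto simp: f_def intro!: borel_integrable_compact continuous_intros)
  also have "\<dots> = (\<Prod>b\<in>Basis. if r \<bullet> b = 0 then of_real L else 0)"
  proof (rule prod.cong[OF refl])
    fix b :: 'a assume "b \<in> Basis"
    then obtain m :: int where "r \<bullet> b = 2 * pi / L * of_int m" using r by (auto simp: lattice_def)
    then show "(\<integral>t. f b t \<partial>lborel) = (if r \<bullet> b = 0 then of_real L else 0)"
      unfolding f_def by (rule integral_cis_period[OF L])
  qed
  also have "\<dots> = (if r = 0 then of_real (L ^ DIM('a)) else 0)"
  proof (cases "r = 0")
    case False
    then obtain b where "b \<in> Basis" "r \<bullet> b \<noteq> 0" by (auto simp: euclidean_eq_iff[of r])
    then show ?thesis using False by (auto intro!: prod_zero)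
  qed simp
  finally show ?thesis .
qed

section \<open>Quadratic forms on the span of an eigensystem\<close>

lemma orthonormal_combination_inner:
  fixes e :: "nat \<Rightarrow> 'i \<Rightarrow> real"
  assumes on: "\<And>i j. i < m \<Longrightarrow> j < m \<Longrightarrow> (\<Sum>x\<in>I. e i x * e j x) = (if i = j then 1 else 0)"
  shows "(\<Sum>x\<in>I. (\<Sum>j<m. a j * e j x) * (\<Sum>j<m. b j * e j x)) = (\<Sum>j<m. a j * b j)"
proof -
  have "(\<Sum>x\<in>I. (\<Sum>j<m. a j * e j x) * (\<Sum>j<m. b j * e j x))
      = (\<Sum>x\<in>I. \<Sum>i<m. \<Sum>j<m. a i * b j * (e i x * e j x))"
    by (simp add: sum_product mult_ac)
  also have "\<dots> = (\<Sum>i<m. \<Sum>x\<in>I. \<Sum>j<m. a i * b j * (e i x * e j x))"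
    by (rule sum.swap)
  also have "\<dots> = (\<Sum>i<m. \<Sum>j<m. a i * b j * (\<Sum>x\<in>I. e i x * e j x))"
    by (intro sum.cong refl, subst sum.swap) (simp add: sum_distrib_left)
  also have "\<dots> = (\<Sum>i<m. a i * b i)"
  proof (rule sum.cong[OF refl])
    fix i assume i: "i \<in> {..<m}"
    then have "(\<Sum>j<m. a i * b j * (\<Sum>x\<in>I. e i x * e j x)) = (\<Sum>j<m. if i = j then a i * b j else 0)"
      using on by (intro sum.cong) auto
    then show "(\<Sum>j<m. a i * b j * (\<Sum>x\<in>I. e i x * e j x)) = a i * b i" using i by simp
  qed
  finally show ?thesis .
qed

text \<open>In the coordinates given by orthonormal eigenvectors the form is diagonal.\<close>

lemma qform_eigensystem:
  assumes sys: "eigensystem I M s e l" and m: "m \<le> s"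
  shows "qform I M (\<lambda>x. \<Sum>j<m. c j * e j x) = (\<Sum>j<m. l j * (c j)\<^sup>2)"
proof -
  have "(\<Sum>y\<in>I. M x y * (\<Sum>j<m. c j * e j y)) = (\<Sum>j<m. (c j * l j) * e j x)" if x: "x \<in> I" for x
  proof -
    have "(\<Sum>y\<in>I. M x y * (\<Sum>j<m. c j * e j y)) = (\<Sum>j<m. c j * (\<Sum>y\<in>I. M x y * e j y))"
      unfolding sum_distrib_left by (subst sum.swap) (simp add: mult_ac)
    then show ?thesis using sys m x by (simp add: eigensystem_def mult.assoc)
  qed
  then have "qform I M (\<lambda>x. \<Sum>j<m. c j * e j x)
      = (\<Sum>x\<in>I. (\<Sum>j<m. (c j * l j) * e j x) * (\<Sum>j<m. c j * e j x))"
    by (rule qform_eq_sum_eigen)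
  also have "\<dots> = (\<Sum>j<m. (c j * l j) * c j)"
    using sys m by (intro orthonormal_combination_inner) (auto simp: eigensystem_def)
  finally show ?thesis by (simp add: power2_eq_square mult_ac)
qed

lemma sum_squares_eigensystem:
  assumes sys: "eigensystem I M s e l" and m: "m \<le> s"
  shows "(\<Sum>x\<in>I. (\<Sum>j<m. c j * e j x)\<^sup>2) = (\<Sum>j<m. (c j)\<^sup>2)"
  using orthonormal_combination_inner[of m e I c c] sys m
  by (auto simp: eigensystem_def power2_eq_square)

section \<open>Surface waves on cubes and on the free surface\<close>

lemma integral_cos_sin_cube:
  fixes a r :: "'a::euclidean_space"
  assumes L: "L > 0" and r: "r \<in> lattice (2 * pi / L)"
  defines "Q \<equiv> cbox a (a + L *\<^sub>R One)"
  shows "(\<integral>x. cos (r \<bullet> x) \<partial>lebesgue_on Q) = (if r = 0 then L ^ DIM('a) else 0)"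
    and "(\<integral>x. sin (r \<bullet> x) \<partial>lebesgue_on Q) = 0"
proof -
  let ?f = "\<lambda>x. indicator Q x *\<^sub>R cis (r \<bullet> x)"
  have int: "integrable lborel ?f"
    unfolding Q_def by (intro borel_integrable_compact continuous_intros) auto
  have [measurable]: "Q \<in> sets borel" by (simp add: Q_def)
  have *: "(\<integral>x. g (r \<bullet> x) \<partial>lebesgue_on Q) = (\<integral>x. indicator Q x *\<^sub>R g (r \<bullet> x) \<partial>lborel)"
    if [measurable]: "g \<in> borel_measurable borel" for g :: "real \<Rightarrow> real"
    by (simp add: integral_restrict_space Q_def integral_completion)
  have "(\<integral>x. cos (r \<bullet> x) \<partial>lebesgue_on Q) = (\<integral>x. Re (?f x) \<partial>lborel)"
    by (subst *) auto
  also have "\<dots> = Re (\<integral>x. ?f x \<partial>lborel)" by (rule integral_Re[OF int])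
  finally show "(\<integral>x. cos (r \<bullet> x) \<partial>lebesgue_on Q) = (if r = 0 then L ^ DIM('a) else 0)"
    unfolding Q_def integral_cis_cube[OF L r] by (simp del: of_real_power)
  have "(\<integral>x. sin (r \<bullet> x) \<partial>lebesgue_on Q) = (\<integral>x. Im (?f x) \<partial>lborel)"
    by (subst *) auto
  also have "\<dots> = Im (\<integral>x. ?f x \<partial>lborel)" by (rule integral_Im[OF int])
  finally show "(\<integral>x. sin (r \<bullet> x) \<partial>lebesgue_on Q) = 0"
    unfolding Q_def integral_cis_cube[OF L r] by (simp del: of_real_power)
qed

lemma continuous_on_wave_surface: "continuous_on A (\<lambda>y. wave p (y, 0))"
  unfolding wave_surface by (intro continuous_intros)

text \<open>The product equals cos of the difference frequency plus sin of the sum frequency. The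
  sine always integrates to 0, so all waves, the constant one included, have the same norm.\<close>

lemma wave_orthogonal_cube:
  fixes a p q :: "'a::euclidean_space"
  assumes L: "L > 0" and p: "p \<in> lattice (2 * pi / L)" and q: "q \<in> lattice (2 * pi / L)"
  shows "(\<integral>y. wave p (y, 0) * wave q (y, 0) \<partial>lebesgue_on (cbox a (a + L *\<^sub>R One)))
     = (if p = q then L ^ DIM('a) else 0)"
proof -
  have "wave p (y, 0) * wave q (y, 0) = cos ((p - q) \<bullet> y) + sin ((p + q) \<bullet> y)" for y
    by (simp add: wave_surface inner_diff_left inner_add_left cos_diff sin_add algebra_simps)
  moreover have "integrable (lebesgue_on (cbox a (a + L *\<^sub>R One))) (\<lambda>y. cos ((p - q) \<bullet> y))"
    "integrable (lebesgue_on (cbox a (a + L *\<^sub>R One))) (\<lambda>y. sin ((p + q) \<bullet> y))"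
    by (intro continuous_integrable_on_bounded continuous_intros; simp)+
  ultimately show ?thesis
    using integral_cos_sin_cube[OF L lattice_diff[OF p q], of a] integral_cos_sin_cube[OF L lattice_add[OF p q], of a]
    by simp
qed

text \<open>Links integrals to Gram matrices; it is applied to gradients on \<open>\<Omega>\<close>
  and to surface values on \<open>F\<close> and on the cube.\<close>

lemma integral_square_sum:
  fixes f :: "'i \<Rightarrow> 'b::euclidean_space \<Rightarrow> 'c::euclidean_space"
  assumes "bounded S" "S \<in> sets lebesgue" and cont: "\<And>p. p \<in> P \<Longrightarrow> continuous_on UNIV (f p)"
  shows "(\<integral>x. (norm (\<Sum>p\<in>P. c p *\<^sub>R f p x))\<^sup>2 \<partial>lebesgue_on S) =
    qform P (\<lambda>p q. \<integral>x. f p x \<bullet> f q x \<partial>lebesgue_on S) c"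
proof -
  have int: "integrable (lebesgue_on S) (\<lambda>x. c p * c q * (f p x \<bullet> f q x))" if "p \<in> P" "q \<in> P" for p q
    using that by (intro continuous_integrable_on_bounded assms continuous_intros)
  have "(norm (\<Sum>p\<in>P. c p *\<^sub>R f p x))\<^sup>2 = (\<Sum>p\<in>P. \<Sum>q\<in>P. c p * c q * (f p x \<bullet> f q x))" for x
    by (simp add: power2_norm_eq_inner inner_sum_left inner_sum_right sum_distrib_left mult_ac)
       (intro sum.cong refl, simp add: inner_commute)
  then have "(\<integral>x. (norm (\<Sum>p\<in>P. c p *\<^sub>R f p x))\<^sup>2 \<partial>lebesgue_on S)
      = (\<Sum>p\<in>P. \<Sum>q\<in>P. \<integral>x. c p * c q * (f p x \<bullet> f q x) \<partial>lebesgue_on S)"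
    using int by simp
  then show ?thesis by (simp add: qform_def mult_ac)
qed

text \<open>Enlarging \<open>F\<close> to the cube only increases the integral, and there the waves
  are orthogonal with common squared norm \<open>L ^ DIM('a)\<close>.\<close>

lemma wave_bessel:
  fixes a :: "'a::euclidean_space"
  assumes L: "L > 0" and P: "finite P" "P \<subseteq> lattice (2 * pi / L)"
    and F: "F \<in> sets lebesgue" "F \<subseteq> cbox a (a + L *\<^sub>R One)"
  shows "(\<integral>y. (\<Sum>p\<in>P. c p * wave p (y, 0))\<^sup>2 \<partial>lebesgue_on F) \<le> L ^ DIM('a) * (\<Sum>p\<in>P. (c p)\<^sup>2)"
proof -
  let ?Q = "cbox a (a + L *\<^sub>R One)"
  let ?f = "\<lambda>y. (\<Sum>p\<in>P. c p * wave p (y, 0))\<^sup>2"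
  have "(\<integral>y. ?f y \<partial>lebesgue_on F) \<le> (\<integral>y. ?f y \<partial>lebesgue_on ?Q)"
    by (rule integral_mono_lebesgue_on_AE)
       (use F in \<open>auto intro!: continuous_integrable_on_bounded continuous_intros continuous_on_wave_surface\<close>)
  also have "\<dots> = qform P (\<lambda>p q. \<integral>y. wave p (y, 0) * wave q (y, 0) \<partial>lebesgue_on ?Q) c"
    using integral_square_sum[of ?Q P "\<lambda>p y. wave p (y, 0)" c, OF _ _ continuous_on_wave_surface] by simp
  also have "\<dots> = (\<Sum>p\<in>P. \<Sum>q\<in>P. if p = q then L ^ DIM('a) * c p * c q else 0)"
    unfolding qform_def using P by (intro sum.cong refl) (simp add: wave_orthogonal_cube[OF L] subset_eq)
  also have "\<dots> = L ^ DIM('a) * (\<Sum>p\<in>P. (c p)\<^sup>2)"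
    using P by (simp add: sum_distrib_left power2_eq_square mult_ac)
  finally show ?thesis .
qed

text \<open>The square of a surface wave is 1 plus a sine that is odd in \<open>p\<close>; the sines
  cancel in pairs over the symmetric set \<open>P\<close>. The trace of the mass matrix is therefore
  exact.\<close>

lemma sum_wave_surface_square:
  fixes F :: "'a::euclidean_space set"
  assumes "finite P" and sym: "uminus ` P = P" and "compact F"
  shows "(\<Sum>p\<in>P. \<integral>y. (wave p (y, 0))\<^sup>2 \<partial>lebesgue_on F) = real (card P) * measure lebesgue F"
proof -
  have F: "bounded F" "F \<in> sets lebesgue" using assms(3) by (auto simp: compact_imp_bounded borel_compact)
  let ?s = "\<lambda>p. \<integral>y. sin (2 * (p \<bullet> y)) \<partial>lebesgue_on F"
  have "(\<integral>y. (wave p (y, 0))\<^sup>2 \<partial>lebesgue_on F) = measure lebesgue F + ?s p" for p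
  proof -
    have "(wave p (y, 0))\<^sup>2 = 1 + sin (2 * (p \<bullet> y))" for y
    proof -
      have "(wave p (y, 0))\<^sup>2 = (sin (p \<bullet> y))\<^sup>2 + (cos (p \<bullet> y))\<^sup>2 + 2 * sin (p \<bullet> y) * cos (p \<bullet> y)"
        unfolding wave_surface by algebra
      then show ?thesis by (simp add: sin_double)
    qed
    moreover have "integrable (lebesgue_on F) (\<lambda>y. 1::real)" "integrable (lebesgue_on F) (\<lambda>y. sin (2 * (p \<bullet> y)))"
      by (intro continuous_integrable_on_bounded F continuous_intros)+
    ultimately show ?thesis using F by (simp add: measure_restrict_space)
  qed
  then have "(\<Sum>p\<in>P. \<integral>y. (wave p (y, 0))\<^sup>2 \<partial>lebesgue_on F) = real (card P) * measure lebesgue F + (\<Sum>p\<in>P. ?s p)"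
    by (simp add: sum.distrib)
  moreover have "(\<Sum>p\<in>P. ?s p) = 0"
  proof -
    have "(\<Sum>p\<in>P. ?s p) = (\<Sum>p\<in>uminus ` P. ?s p)" by (simp add: sym)
    also have "\<dots> = (\<Sum>p\<in>P. ?s (- p))" by (subst sum.reindex) (auto simp: inj_on_def)
    also have "\<dots> = - (\<Sum>p\<in>P. ?s p)" by (simp add: sum_negf)
    finally show ?thesis by simp
  qed
  ultimately show ?thesis by simp
qed

section \<open>Comparison with the min-max values\<close>

text \<open>Write a and b for the two forms at \<open>C\<close>. The first hypothesis rearranges to
  a \<le> (z - \<kappa>) b. The second forces b > 0 because a is nonnegative, so the quotient is not
  the infinite default.\<close>

lemma rayleigh_wave_sum_le:
  fixes F :: "'a::euclidean_space set" and P :: "'a set" and z :: real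
  assumes \<Omega>: "open \<Omega>" "bounded \<Omega>" and F: "compact F"
  defines "A \<equiv> \<lambda>p q. \<integral>x. wave_grad p x \<bullet> wave_grad q x \<partial>lebesgue_on \<Omega>"
    and "B \<equiv> \<lambda>p q. \<integral>y. wave p (y, 0) * wave q (y, 0) \<partial>lebesgue_on F"
  assumes pos: "qform P (\<lambda>p q. z * B p q - A p q) C \<ge> \<kappa> * qform P B C"
    and pos': "qform P (\<lambda>p q. z * B p q - A p q) C > 0"
  shows "\<kappa> \<le> z" and "rayleigh \<Omega> F (\<lambda>x. \<Sum>p\<in>P. C p *\<^sub>R wave_grad p x) (\<lambda>y. \<Sum>p\<in>P. C p * wave p (y, 0)) \<le> ennreal (z - \<kappa>)"
proof -
  have F': "bounded F" "F \<in> sets lebesgue" using F by (auto simp: compact_imp_bounded borel_compact)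
  have \<Omega>': "\<Omega> \<in> sets lebesgue" using \<Omega> by simp
  have a: "(\<integral>x. (norm (\<Sum>p\<in>P. C p *\<^sub>R wave_grad p x))\<^sup>2 \<partial>lebesgue_on \<Omega>) = qform P A C"
    unfolding A_def by (rule integral_square_sum[OF \<Omega>(2) \<Omega>' continuous_on_wave_grad])
  have b: "(\<integral>y. (\<Sum>p\<in>P. C p * wave p (y, 0))\<^sup>2 \<partial>lebesgue_on F) = qform P B C"
    using integral_square_sum[OF F' continuous_on_wave_surface, where P = P and c = C] by (simp add: B_def)
  have split: "qform P (\<lambda>p q. z * B p q - A p q) C = z * qform P B C - qform P A C"
    by (simp add: qform_def left_diff_distrib sum_subtractf sum_distrib_left mult.assoc)
  have a0: "qform P A C \<ge> 0" unfolding a[symmetric] by (rule integral_nonneg_AE) simp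
  have b0: "qform P B C \<ge> 0" unfolding b[symmetric] by (rule integral_nonneg_AE) simp
  moreover have "qform P B C \<noteq> 0" using pos' a0 by (auto simp: split)
  ultimately have b1: "qform P B C > 0" by linarith
  have le: "qform P A C \<le> (z - \<kappa>) * qform P B C" using pos by (simp add: split algebra_simps)
  then show \<kappa>: "\<kappa> \<le> z" using a0 b1 by (smt (verit) mult_neg_pos)
  have sa: "sq_norm_L2 \<Omega> (\<lambda>x. \<Sum>p\<in>P. C p *\<^sub>R wave_grad p x) = ennreal (qform P A C)"
    unfolding sq_norm_L2_def a[symmetric]
    by (intro nn_integral_eq_integral continuous_integrable_on_bounded \<Omega> \<Omega>' continuous_intros
          continuous_on_wave_grad) simp
  have "sq_norm_L2 F (\<lambda>y. \<Sum>p\<in>P. C p * wave p (y, 0)) = ennreal (\<integral>y. (\<Sum>p\<in>P. C p * wave p (y, 0))\<^sup>2 \<partial>lebesgue_on F)"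
    unfolding sq_norm_L2_def real_norm_def power2_abs
    by (intro nn_integral_eq_integral continuous_integrable_on_bounded F' continuous_intros
          continuous_on_wave_surface) simp
  then have sb: "sq_norm_L2 F (\<lambda>y. \<Sum>p\<in>P. C p * wave p (y, 0)) = ennreal (qform P B C)"
    by (simp add: b)
  show "rayleigh \<Omega> F (\<lambda>x. \<Sum>p\<in>P. C p *\<^sub>R wave_grad p x) (\<lambda>y. \<Sum>p\<in>P. C p * wave p (y, 0)) \<le> ennreal (z - \<kappa>)"
    unfolding rayleigh_def sa sb using b1 a0 le
    by (simp add: divide_ennreal ennreal_leI pos_divide_le_eq)
qed

text \<open>The trial space is spanned by the eigenvectors numbered 0 to \<open>i\<close>. On it the
  form of \<open>z B - A\<close> is at least \<open>l i\<close> times the squared norm of the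
  coefficients, which by Bessel dominates \<open>l i / L ^ DIM('a)\<close> times the form of
  \<open>B\<close>. Eigenvectors are counted from 0 and min-max values from 1, hence
  \<open>Suc i\<close>.\<close>

lemma sloshing_minmax_le:
  fixes F :: "'a::euclidean_space set" and P :: "'a set" and z :: real
  assumes \<Omega>: "open \<Omega>" "bounded \<Omega>" and F: "compact F" "F \<subseteq> cbox a (a + L *\<^sub>R One)"
    and L: "L > 0" and P: "finite P" "P \<subseteq> lattice (2 * pi / L)"
  defines "A \<equiv> \<lambda>p q. \<integral>x. wave_grad p x \<bullet> wave_grad q x \<partial>lebesgue_on \<Omega>"
    and "B \<equiv> \<lambda>p q. \<integral>y. wave p (y, 0) * wave q (y, 0) \<partial>lebesgue_on F"
  assumes sys: "eigensystem P (\<lambda>p q. z * B p q - A p q) s e l" and i: "i < s"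
  shows "l i / L ^ DIM('a) \<le> z" and "sloshing_minmax \<Omega> F (Suc i) \<le> ennreal (z - l i / L ^ DIM('a))"
proof -
  let ?M = "\<lambda>p q. z * B p q - A p q"
  have F': "bounded F" "F \<in> sets lebesgue" using F by (auto simp: compact_imp_bounded borel_compact)
  have l: "l i > 0" "\<And>j. j \<le> i \<Longrightarrow> l i \<le> l j" using sys i by (auto simp: eigensystem_def)
  define u where "u j x = (\<Sum>p\<in>P. e j p * wave p x)" for j x
  have u: "smooth_on (u j) UNIV" for j unfolding u_def[abs_def] by (rule smooth_on_wave_sum)
  have key: "l i / L ^ DIM('a) \<le> z \<and>
      rayleigh \<Omega> F (\<lambda>x. \<Sum>j<Suc i. c j *\<^sub>R grad (u j) x) (\<lambda>y. \<Sum>j<Suc i. c j * u j (y, 0)) \<le> ennreal (z - l i / L ^ DIM('a))"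
    if c: "\<exists>j<Suc i. c j \<noteq> 0" for c :: "nat \<Rightarrow> real"
  proof -
    define C where "C p = (\<Sum>j<Suc i. c j * e j p)" for p
    have g: "(\<Sum>j<Suc i. c j *\<^sub>R grad (u j) x) = (\<Sum>p\<in>P. C p *\<^sub>R wave_grad p x)" for x
      unfolding u_def[abs_def] grad_wave_sum C_def scaleR_sum_left scaleR_sum_right
      by (subst sum.swap) simp
    have t: "(\<Sum>j<Suc i. c j * u j (y, 0)) = (\<Sum>p\<in>P. C p * wave p (y, 0))" for y
      unfolding u_def C_def sum_distrib_left sum_distrib_right
      by (subst sum.swap) (simp add: mult.assoc)
    have m: "Suc i \<le> s" using i by simp
    have C2: "(\<Sum>p\<in>P. (C p)\<^sup>2) = (\<Sum>j<Suc i. (c j)\<^sup>2)"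
      unfolding C_def by (rule sum_squares_eigensystem[OF sys m])
    obtain j where j: "j < Suc i" "c j \<noteq> 0" using c by blast
    have "(c j)\<^sup>2 \<le> (\<Sum>j<Suc i. (c j)\<^sup>2)" by (rule member_le_sum) (use j in auto)
    then have Cpos: "(\<Sum>p\<in>P. (C p)\<^sup>2) > 0" using j unfolding C2 by (smt (verit) zero_less_power2)
    have "qform P ?M C = (\<Sum>j<Suc i. l j * (c j)\<^sup>2)"
      unfolding C_def by (rule qform_eigensystem[OF sys m])
    also have "\<dots> \<ge> (\<Sum>j<Suc i. l i * (c j)\<^sup>2)"
      by (intro sum_mono mult_right_mono l) auto
    finally have Q: "qform P ?M C \<ge> l i * (\<Sum>p\<in>P. (C p)\<^sup>2)"
      by (simp only: C2 sum_distrib_left)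
    have "qform P B C = (\<integral>y. (\<Sum>p\<in>P. C p * wave p (y, 0))\<^sup>2 \<partial>lebesgue_on F)"
      using integral_square_sum[OF F' continuous_on_wave_surface, where P = P and c = C] by (simp add: B_def)
    also have "\<dots> \<le> L ^ DIM('a) * (\<Sum>p\<in>P. (C p)\<^sup>2)"
      by (rule wave_bessel[OF L P F'(2) F(2)])
    finally have "qform P B C \<le> L ^ DIM('a) * (\<Sum>p\<in>P. (C p)\<^sup>2)" .
    then have "l i / L ^ DIM('a) * qform P B C \<le> l i / L ^ DIM('a) * (L ^ DIM('a) * (\<Sum>p\<in>P. (C p)\<^sup>2))"
      using l L by (intro mult_left_mono) auto
    also have "\<dots> = l i * (\<Sum>p\<in>P. (C p)\<^sup>2)" using L by simp
    finally have 1: "qform P ?M C \<ge> l i / L ^ DIM('a) * qform P B C" using Q by linarith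
    have "l i * (\<Sum>p\<in>P. (C p)\<^sup>2) > 0" using l Cpos by simp
    then have 2: "qform P ?M C > 0" using Q by linarith
    show ?thesis
      unfolding g t
      using rayleigh_wave_sum_le[OF \<Omega> F(1) 1[unfolded A_def B_def] 2[unfolded A_def B_def]] by blast
  qed
  show "l i / L ^ DIM('a) \<le> z" using key[of "\<lambda>_. 1"] by auto
  have "sloshing_minmax \<Omega> F (Suc i) \<le> (SUP c \<in> {c :: nat \<Rightarrow> real. \<exists>j<Suc i. c j \<noteq> 0}.
      rayleigh \<Omega> F (\<lambda>x. \<Sum>j<Suc i. c j *\<^sub>R grad (u j) x) (\<lambda>y. \<Sum>j<Suc i. c j * u j (y, 0)))"
    unfolding sloshing_minmax_def
    by (rule INF_lower2[of "(u, \<lambda>j. grad (u j), \<lambda>j y. u j (y, 0))"])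
       (use H1_gradient_smooth[OF \<Omega> u] H1_trace_smooth[OF F' u] in auto)
  also have "\<dots> \<le> ennreal (z - l i / L ^ DIM('a))"
    by (rule SUP_least) (use key in auto)
  finally show "sloshing_minmax \<Omega> F (Suc i) \<le> ennreal (z - l i / L ^ DIM('a))" .
qed

text \<open>The trace of \<open>z B - A\<close> is bounded below by the diagonal estimates and above
  by its positive eigenvalues. The minimum with \<open>z\<close> is taken because the min-max values
  are not yet known to be finite, and \<open>enn2real\<close> would send infinity to 0.\<close>

lemma lattice_riesz_sum_le:
  fixes F :: "'a::euclidean_space set" and P :: "'a set" and z :: real
  assumes \<Omega>: "open \<Omega>" "bounded \<Omega>" and F: "compact F" "F \<subseteq> cbox a (a + L *\<^sub>R One)"
    and john: "\<Omega> \<subseteq> F \<times> {..<0}"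
    and L: "L > 0" and P: "finite P" "P \<subseteq> lattice (2 * pi / L)" "uminus ` P = P"
    and z: "0 \<le> z" "ennreal z \<le> sloshing_minmax \<Omega> F (Suc k)"
  shows "measure lebesgue F * (\<Sum>p\<in>P. z - norm p)
    \<le> L ^ DIM('a) * (\<Sum>i<k. z - enn2real (min (ennreal z) (sloshing_minmax \<Omega> F (Suc i))))"
proof -
  define A where "A = (\<lambda>p q. \<integral>x. wave_grad p x \<bullet> wave_grad q x \<partial>lebesgue_on \<Omega>)"
  define B where "B = (\<lambda>p q. \<integral>y. wave p (y, 0) * wave q (y, 0) \<partial>lebesgue_on F)"
  define D where "D i = z - enn2real (min (ennreal z) (sloshing_minmax \<Omega> F (Suc i)))" for i
  have Ld: "L ^ DIM('a) > 0" using L by simp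
  have "z * B p q - A p q = z * B q p - A q p" for p q
    by (simp add: A_def B_def inner_commute mult.commute)
  then obtain s e l where s: "s \<le> Suc k" and sys: "eigensystem P (\<lambda>p q. z * B p q - A p q) s e l"
    and tr: "s < Suc k \<Longrightarrow> (\<Sum>p\<in>P. z * B p p - A p p) \<le> (\<Sum>i<s. l i)"
    using positive_spectral_truncation[OF P(1), of "\<lambda>p q. z * B p q - A p q" "Suc k"] by blast
  note minmax = sloshing_minmax_le[OF \<Omega> F L P(1,2) sys[unfolded A_def B_def]]
  have l: "l i > 0" if "i < s" for i using sys that by (simp add: eigensystem_def)
  \<comment> \<open>One more positive eigenvalue, at index \<open>k\<close>, would push the min-max
    value of index \<open>Suc k\<close> strictly below \<open>z\<close>. Since \<open>s\<close>
    falls short of the truncation level, the trace bound \<open>tr\<close> is available.\<close>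
  have "s \<noteq> Suc k"
  proof
    assume "s = Suc k"
    then have k: "k < s" by simp
    have "ennreal z \<le> ennreal (z - l k / L ^ DIM('a))"
      using z(2) minmax(2)[OF k] by (rule order_trans)
    then have "z \<le> z - l k / L ^ DIM('a)" using minmax(1)[OF k] by (simp add: ennreal_le_iff)
    then show False using l[OF k] Ld by (simp add: zero_less_divide_iff not_less[symmetric])
  qed
  with s have sk: "s \<le> k" by simp
  have lD: "l i \<le> L ^ DIM('a) * D i" if i: "i < s" for i
  proof -
    have "min (ennreal z) (sloshing_minmax \<Omega> F (Suc i)) \<le> ennreal (z - l i / L ^ DIM('a))"
      using minmax(2)[OF i] by (rule min.coboundedI2)
    then have "enn2real (min (ennreal z) (sloshing_minmax \<Omega> F (Suc i))) \<le> z - l i / L ^ DIM('a)"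
      using minmax(1)[OF i] by (intro enn2real_leI) auto
    then have "l i / L ^ DIM('a) \<le> D i" by (simp add: D_def)
    then show ?thesis using Ld by (simp add: pos_divide_le_eq mult.commute)
  qed
  have D0: "D i \<ge> 0" for i
    using enn2real_leI[of z "min (ennreal z) (sloshing_minmax \<Omega> F (Suc i))"] z(1) by (simp add: D_def)
  have "measure lebesgue F * (\<Sum>p\<in>P. z - norm p) = z * (real (card P) * measure lebesgue F) - (\<Sum>p\<in>P. measure lebesgue F * norm p)"
    by (simp add: sum_subtractf sum_distrib_left[symmetric] sum_distrib_right[symmetric] right_diff_distrib mult_ac)
  also have "\<dots> \<le> z * (\<Sum>p\<in>P. B p p) - (\<Sum>p\<in>P. A p p)"
  proof -
    have "(\<Sum>p\<in>P. B p p) = real (card P) * measure lebesgue F"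
      unfolding B_def power2_eq_square[symmetric] by (rule sum_wave_surface_square[OF P(1,3) F(1)])
    moreover have "(\<Sum>p\<in>P. A p p) \<le> (\<Sum>p\<in>P. measure lebesgue F * norm p)"
      unfolding A_def power2_norm_eq_inner[symmetric]
      by (intro sum_mono wave_energy_le \<Omega> F john)
    ultimately show ?thesis by simp
  qed
  also have "\<dots> = (\<Sum>p\<in>P. z * B p p - A p p)" by (simp add: sum_subtractf sum_distrib_left)
  also have "\<dots> \<le> (\<Sum>i<s. l i)" using tr sk by simp
  also have "\<dots> \<le> (\<Sum>i<s. L ^ DIM('a) * D i)" by (intro sum_mono lD) simp
  \<comment> \<open>The \<open>k - s\<close> extra terms are nonnegative by
    \<open>D0\<close>.\<close>
  also have "\<dots> \<le> (\<Sum>i<k. L ^ DIM('a) * D i)"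
    using sk D0 Ld by (intro sum_mono2) auto
  finally show ?thesis by (simp add: D_def sum_distrib_left)
qed

text \<open>Dropping the last function of a family leaves a smaller trial space: its combinations
  are those of the larger family with last coefficient 0.\<close>

lemma sloshing_minmax_mono: "sloshing_minmax \<Omega> F k \<le> sloshing_minmax \<Omega> F (Suc k)"
  unfolding sloshing_minmax_def
proof (rule INF_mono)
  fix t :: "(nat \<Rightarrow> 'a \<times> real \<Rightarrow> real) \<times> (nat \<Rightarrow> 'a \<times> real \<Rightarrow> 'a \<times> real) \<times> (nat \<Rightarrow> 'a \<Rightarrow> real)"
  obtain u G g where t: "t = (u, G, g)" by (cases t)
  let ?R = "\<lambda>m c. rayleigh \<Omega> F (\<lambda>x. \<Sum>i<m. c i *\<^sub>R G i x) (\<lambda>y. \<Sum>i<m. c i * g i y)"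
  assume mem: "t \<in> {(u, G, g). \<forall>i<Suc k. H1_gradient \<Omega> (u i) (G i) \<and> H1_trace \<Omega> F (u i) (G i) (g i)}"
  have "(SUP c \<in> {c :: nat \<Rightarrow> real. \<exists>i<k. c i \<noteq> 0}. ?R k c) \<le> (SUP c \<in> {c :: nat \<Rightarrow> real. \<exists>i<Suc k. c i \<noteq> 0}. ?R (Suc k) c)"
  proof (rule SUP_mono)
    fix c :: "nat \<Rightarrow> real" assume "c \<in> {c. \<exists>i<k. c i \<noteq> 0}"
    then obtain i where i: "i < k" "c i \<noteq> 0" by auto
    define c' where "c' = c(k := 0)"
    have "c' \<in> {c. \<exists>i<Suc k. c i \<noteq> 0}" using i by (auto simp: c'_def intro!: exI[of _ i])
    moreover have "?R k c \<le> ?R (Suc k) c'" by (simp add: c'_def)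
    ultimately show "\<exists>c'\<in>{c. \<exists>i<Suc k. c i \<noteq> 0}. ?R k c \<le> ?R (Suc k) c'" by (intro bexI[of _ c'])
  qed
  moreover have "(u, G, g) \<in> {(u, G, g). \<forall>i<k. H1_gradient \<Omega> (u i) (G i) \<and> H1_trace \<Omega> F (u i) (G i) (g i)}"
    using mem by (simp add: t)
  ultimately show "\<exists>t'\<in>{(u, G, g). \<forall>i<k. H1_gradient \<Omega> (u i) (G i) \<and> H1_trace \<Omega> F (u i) (G i) (g i)}.
     (case t' of (u, G, g) \<Rightarrow> SUP c \<in> {c :: nat \<Rightarrow> real. \<exists>i<k. c i \<noteq> 0}.
          rayleigh \<Omega> F (\<lambda>x. \<Sum>i<k. c i *\<^sub>R G i x) (\<lambda>y. \<Sum>i<k. c i * g i y))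
     \<le> (case t of (u, G, g) \<Rightarrow> SUP c \<in> {c :: nat \<Rightarrow> real. \<exists>i<Suc k. c i \<noteq> 0}.
          rayleigh \<Omega> F (\<lambda>x. \<Sum>i<Suc k. c i *\<^sub>R G i x) (\<lambda>y. \<Sum>i<Suc k. c i * g i y))"
    unfolding t by (intro bexI[of _ "(u, G, g)"]) (simp_all only: prod.case)
qed

section \<open>Counting lattice points\<close>

lemma finite_lattice_ball:
  assumes h: "h > 0"
  shows "finite {p \<in> lattice h :: 'a::euclidean_space set. norm p < t}"
proof -
  define K where "K = \<lceil>t / h\<rceil>"
  let ?S = "PiE (Basis :: 'a set) (\<lambda>_. {-K..K})"
  have "{p \<in> lattice h. norm p < t} \<subseteq> (\<lambda>f. \<Sum>b\<in>Basis. (h * of_int (f b)) *\<^sub>R b) ` ?S"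
  proof
    fix p :: 'a assume "p \<in> {p \<in> lattice h. norm p < t}"
    then have p: "p \<in> lattice h" "norm p < t" by auto
    then obtain m :: "'a \<Rightarrow> int" where m: "\<And>b. b \<in> Basis \<Longrightarrow> p \<bullet> b = h * of_int (m b)"
      unfolding lattice_def by (auto dest!: bchoice)
    have "m b \<in> {-K..K}" if b: "b \<in> Basis" for b
    proof -
      have "h * \<bar>of_int (m b)\<bar> \<le> t"
        using Basis_le_norm[OF b, of p] m[OF b] h p(2) by (simp add: abs_mult)
      then have "\<bar>of_int (m b)\<bar> \<le> t / h" using h by (simp add: pos_le_divide_eq mult.commute)
      also have "\<dots> \<le> of_int K" by (simp add: K_def)
      finally show ?thesis by (simp add: abs_le_iff flip: of_int_abs)
    qed
    then have "restrict m Basis \<in> ?S" by auto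
    moreover have "p = (\<Sum>b\<in>Basis. (h * of_int (restrict m Basis b)) *\<^sub>R b)"
      by (subst euclidean_representation[of p, symmetric]) (auto intro!: sum.cong simp: m)
    ultimately show "p \<in> (\<lambda>f. \<Sum>b\<in>Basis. (h * of_int (f b)) *\<^sub>R b) ` ?S" by blast
  qed
  then show ?thesis by (rule finite_subset) (auto intro!: finite_imageI finite_PiE)
qed

text \<open>Rounding the coordinates down gives the lower corner of a grid cell containing
  \<open>x\<close>. The norm bound uses the crude l1 estimate of the displacement, whose error
  disappears as \<open>h\<close> tends to 0.\<close>

lemma lattice_point_near:
  fixes x :: "'a::euclidean_space"
  assumes h: "h > 0"
  obtains p where "p \<in> lattice h" "x \<in> cbox p (p + h *\<^sub>R One)" "norm p \<le> norm x + h * DIM('a)"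
proof
  define p :: 'a where "p = (\<Sum>b\<in>Basis. (h * of_int \<lfloor>x \<bullet> b / h\<rfloor>) *\<^sub>R b)"
  have pb: "p \<bullet> b = h * of_int \<lfloor>x \<bullet> b / h\<rfloor>" if "b \<in> Basis" for b
    using that by (simp add: p_def inner_sum_left inner_Basis if_distrib cong: if_cong)
  then show "p \<in> lattice h" by (auto simp: lattice_def)
  have bd: "p \<bullet> b \<le> x \<bullet> b \<and> x \<bullet> b \<le> p \<bullet> b + h" if b: "b \<in> Basis" for b
  proof -
    have "of_int \<lfloor>x \<bullet> b / h\<rfloor> \<le> x \<bullet> b / h" "x \<bullet> b / h \<le> of_int \<lfloor>x \<bullet> b / h\<rfloor> + 1" by linarith+
    then have "h * of_int \<lfloor>x \<bullet> b / h\<rfloor> \<le> h * (x \<bullet> b / h)" "h * (x \<bullet> b / h) \<le> h * (of_int \<lfloor>x \<bullet> b / h\<rfloor> + 1)"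
      using h by (intro mult_left_mono; simp)+
    then show ?thesis using h by (simp add: pb[OF b] distrib_left)
  qed
  then show "x \<in> cbox p (p + h *\<^sub>R One)" by (simp add: mem_box inner_add_left)
  have "norm (p - x) \<le> (\<Sum>b\<in>Basis. \<bar>(p - x) \<bullet> b\<bar>)" by (rule norm_le_l1)
  also have "\<dots> \<le> (\<Sum>b\<in>(Basis::'a set). h)"
    by (intro sum_mono) (use bd in \<open>force simp: inner_diff_left\<close>)
  finally show "norm p \<le> norm x + h * DIM('a)"
    using norm_triangle_ineq[of "p - x" x] by (simp add: mult.commute)
qed

text \<open>Volume comparison: the cells attached to the counted lattice points cover the ball of
  radius \<open>t - h * DIM('a)\<close>.\<close>

lemma lattice_count_ge:
  fixes t h :: real
  assumes h: "h > 0" and t: "t \<ge> h * DIM('a::euclidean_space)"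
  shows "unit_ball_vol (DIM('a)) * (t - h * DIM('a)) ^ DIM('a)
     \<le> h ^ DIM('a) * card {p \<in> lattice h :: 'a set. norm p < t}"
proof -
  let ?P = "{p \<in> lattice h :: 'a set. norm p < t}"
  have fin: "finite ?P" by (rule finite_lattice_ball[OF h])
  have "ball 0 (t - h * DIM('a)) \<subseteq> (\<Union>p\<in>?P. cbox p (p + h *\<^sub>R One))"
  proof
    fix x :: 'a assume x: "x \<in> ball 0 (t - h * DIM('a))"
    obtain p where "p \<in> lattice h" "x \<in> cbox p (p + h *\<^sub>R One)" "norm p \<le> norm x + h * DIM('a)"
      by (rule lattice_point_near[OF h])
    with x show "x \<in> (\<Union>p\<in>?P. cbox p (p + h *\<^sub>R One))" by auto
  qed
  then have "measure lborel (ball 0 (t - h * DIM('a)) :: 'a set) \<le> measure lborel (\<Union>p\<in>?P. cbox p (p + h *\<^sub>R One))"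
    using fin by (intro measure_mono_fmeasurable fmeasurable.finite_UN) auto
  also have "\<dots> \<le> (\<Sum>p\<in>?P. measure lborel (cbox p (p + h *\<^sub>R One)))"
    using fin by (intro measure_UNION_le) auto
  also have "\<dots> = (\<Sum>p\<in>?P. h ^ DIM('a))"
    using h by (intro sum.cong refl) (simp add: content_cbox_if inner_add_left box_eq_empty algebra_simps not_less)
  finally show ?thesis using t by (simp add: content_ball mult.commute)
qed

text \<open>The counting bound is integrated in \<open>t\<close> from \<open>h * DIM('a)\<close>,
  where it starts to hold, up to \<open>z\<close>.\<close>

lemma lattice_riesz_sum_ge:
  fixes z h :: real
  assumes h: "h > 0" and z: "z \<ge> h * DIM('a::euclidean_space)"
  shows "unit_ball_vol (DIM('a)) * (z - h * DIM('a)) ^ Suc (DIM('a)) / Suc (DIM('a))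
     \<le> h ^ DIM('a) * (\<Sum>p\<in>{p \<in> lattice h :: 'a set. norm p < z}. z - norm p)"
proof -
  let ?P = "{p \<in> lattice h :: 'a set. norm p < z}"
  let ?d = "DIM('a)" and ?w = "unit_ball_vol (DIM('a))"
  let ?I = "{h * ?d..z}"
  have fin: "finite ?P" by (rule finite_lattice_ball[OF h])
  have "ennreal (?w * (z - h * ?d) ^ Suc ?d / Suc ?d - ?w * (h * ?d - h * ?d) ^ Suc ?d / Suc ?d)
      = (\<integral>\<^sup>+t. ennreal (?w * (t - h * ?d) ^ ?d) * indicator ?I t \<partial>lborel)"
    using z by (intro nn_integral_FTC_Icc[symmetric]) (auto intro!: derivative_eq_intros simp del: power_Suc)
  \<comment> \<open>\<open>z - |p|\<close> is the integral of the indicator of \<open>{|p|..z}\<close>, so the sum integrates the counting function.\<close>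
  also have "\<dots> \<le> (\<integral>\<^sup>+t. (\<Sum>p\<in>?P. ennreal (h ^ ?d) * indicator {norm p..z} t) \<partial>lborel)"
  proof (rule nn_integral_mono)
    fix t :: real
    show "ennreal (?w * (t - h * ?d) ^ ?d) * indicator ?I t \<le> (\<Sum>p\<in>?P. ennreal (h ^ ?d) * indicator {norm p..z} t)"
    proof (cases "t \<in> ?I")
      case True
      then have t: "h * ?d \<le> t" "t \<le> z" by auto
      have "?w * (t - h * ?d) ^ ?d \<le> h ^ ?d * card {p \<in> lattice h :: 'a set. norm p < t}"
        by (rule lattice_count_ge[OF h t(1)])
      also have "\<dots> = (\<Sum>p\<in>{p \<in> lattice h :: 'a set. norm p < t}. h ^ ?d * indicator {norm p..z} t)"
        using t by (subst sum.cong[OF refl, of _ _ "\<lambda>_. h ^ ?d"]) auto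
      also have "\<dots> \<le> (\<Sum>p\<in>?P. h ^ ?d * indicator {norm p..z} t)"
        using t h fin by (intro sum_mono2) auto
      finally have "ennreal (?w * (t - h * ?d) ^ ?d) \<le> ennreal (\<Sum>p\<in>?P. h ^ ?d * indicator {norm p..z} t)"
        by (rule ennreal_leI)
      also have "\<dots> = (\<Sum>p\<in>?P. ennreal (h ^ ?d * indicator {norm p..z} t))"
        using h by (intro sum_ennreal[symmetric]) auto
      also have "\<dots> = (\<Sum>p\<in>?P. ennreal (h ^ ?d) * indicator {norm p..z} t)"
        by (intro sum.cong refl) (simp split: split_indicator)
      finally show ?thesis using True by simp
    qed simp
  qed
  also have "\<dots> = (\<Sum>p\<in>?P. ennreal (h ^ ?d) * ennreal (z - norm p))"
    by (subst nn_integral_sum) (auto simp: nn_integral_cmult)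
  also have "\<dots> = (\<Sum>p\<in>?P. ennreal (h ^ ?d * (z - norm p)))"
    using h by (intro sum.cong refl) (simp add: ennreal_mult)
  also have "\<dots> = ennreal (\<Sum>p\<in>?P. h ^ ?d * (z - norm p))"
    using h by (intro sum_ennreal) auto
  finally have "?w * (z - h * ?d) ^ Suc ?d / Suc ?d - ?w * (h * ?d - h * ?d) ^ Suc ?d / Suc ?d
      \<le> (\<Sum>p\<in>?P. h ^ ?d * (z - norm p))"
    using h by (subst (asm) ennreal_le_iff) (auto intro!: sum_nonneg)
  then show ?thesis by (simp add: sum_distrib_left)
qed

lemma uminus_lattice_ball: "uminus ` {p \<in> lattice h. norm p < z} = {p \<in> lattice h. norm p < z}"
proof -
  have "uminus ` {p \<in> lattice h. norm p < z} \<subseteq> {p \<in> lattice h. norm p < z}"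
    by (auto simp: lattice_uminus)
  moreover from image_mono[OF this, of uminus]
  have "{p \<in> lattice h. norm p < z} \<subseteq> uminus ` {p \<in> lattice h. norm p < z}"
    by (simp add: image_image)
  ultimately show ?thesis by blast
qed

section \<open>The averaged eigenvalue bound\<close>

text \<open>The spacing \<open>h\<close> and the side \<open>L\<close> satisfy
  \<open>L * h = 2 * pi\<close>. After multiplication by \<open>h ^ DIM('a)\<close> the right side
  is free of \<open>h\<close>, so \<open>h\<close> may tend to 0 on the left.\<close>

lemma riesz_mean_bound:
  fixes F :: "'a::euclidean_space set" and z :: real
  assumes \<Omega>: "open \<Omega>" "bounded \<Omega>" and F: "compact F" and john: "\<Omega> \<subseteq> F \<times> {..<0}"
    and z: "0 \<le> z" "ennreal z \<le> sloshing_minmax \<Omega> F (Suc k)"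
  shows "measure lebesgue F * (unit_ball_vol (DIM('a)) * z ^ Suc (DIM('a)) / Suc (DIM('a)))
    \<le> (2 * pi) ^ DIM('a) * (\<Sum>i<k. z - enn2real (min (ennreal z) (sloshing_minmax \<Omega> F (Suc i))))"
    (is "_ \<le> _ * ?D")
proof (cases "z = 0")
  case True
  then show ?thesis by simp
next
  case False
  with z have z0: "z > 0" by simp
  let ?d = "DIM('a)"
  obtain R where R: "R > 0" "\<And>x. x \<in> F \<Longrightarrow> norm x \<le> R"
    using compact_imp_bounded[OF F] by (auto simp: bounded_pos)
  let ?f = "\<lambda>h::real. measure lebesgue F * (unit_ball_vol ?d * (z - h * ?d) ^ Suc ?d / Suc ?d)"
  have "(?f \<longlongrightarrow> ?f 0) (at_right 0)"
    by (intro tendsto_intros) auto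
  moreover have "\<forall>\<^sub>F h in at_right 0. ?f h \<le> (2 * pi) ^ ?d * ?D"
    unfolding eventually_at_right_field
  proof (intro exI conjI allI impI)
    \<comment> \<open>The first bound on \<open>h\<close> meets the hypothesis of the lattice
      estimate; the second makes the side \<open>L\<close> at least \<open>2 * R\<close>, so that a
      cube contains \<open>F\<close>.\<close>
    show "0 < min (z / ?d) (pi / R)" using z0 R by simp
    fix h :: real assume h: "0 < h" "h < min (z / ?d) (pi / R)"
    then have hz: "h * ?d \<le> z" and hR: "h * R \<le> pi" using R by (auto simp: pos_less_divide_eq)
    define L where "L = 2 * pi / h"
    have L: "L > 0" "2 * pi / L = h" "L * h = 2 * pi" "2 * R \<le> L"
      using h hR by (auto simp: L_def pos_le_divide_eq mult.commute)
    let ?P = "{p \<in> lattice h :: 'a set. norm p < z}"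
    have FQ: "F \<subseteq> cbox (- R *\<^sub>R One) (- R *\<^sub>R One + L *\<^sub>R One)"
    proof
      fix x assume x: "x \<in> F"
      have "- R \<le> x \<bullet> b \<and> x \<bullet> b \<le> - R + L" if "b \<in> Basis" for b
        using Basis_le_norm[OF that, of x] R(2)[OF x] L(4) by (auto simp: abs_le_iff)
      then show "x \<in> cbox (- R *\<^sub>R One) (- R *\<^sub>R One + L *\<^sub>R One)"
        by (simp add: mem_box inner_add_left inner_diff_left)
    qed
    have "?P \<subseteq> lattice (2 * pi / L)" by (auto simp: L(2))
    then have "measure lebesgue F * (\<Sum>p\<in>?P. z - norm p) \<le> L ^ ?d * ?D"
      by (rule lattice_riesz_sum_le[OF \<Omega> F FQ john L(1) finite_lattice_ball[OF h(1)] _ uminus_lattice_ball z])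
    then have "h ^ ?d * (measure lebesgue F * (\<Sum>p\<in>?P. z - norm p)) \<le> h ^ ?d * (L ^ ?d * ?D)"
      using h by (intro mult_left_mono) auto
    also have "\<dots> = (L * h) ^ ?d * ?D" by (simp add: power_mult_distrib)
    finally have "measure lebesgue F * (h ^ ?d * (\<Sum>p\<in>?P. z - norm p)) \<le> (2 * pi) ^ ?d * ?D"
      unfolding L(3) by (simp add: mult.left_commute)
    moreover have "?f h \<le> measure lebesgue F * (h ^ ?d * (\<Sum>p\<in>?P. z - norm p))"
      by (intro mult_left_mono lattice_riesz_sum_ge h hz) auto
    ultimately show "?f h \<le> (2 * pi) ^ ?d * ?D" by linarith
  qed
  ultimately have "?f 0 \<le> (2 * pi) ^ ?d * ?D"
    by (intro tendsto_upperbound[of ?f _ "at_right 0"]) auto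
  then show ?thesis by simp
qed

text \<open>If the value were infinite, the Riesz mean bound would hold for all nonnegative
  \<open>z\<close>; but its left side grows like the power \<open>DIM('a) + 1\<close> of
  \<open>z\<close>, its right side at most linearly.\<close>

lemma sloshing_minmax_finite:
  fixes F :: "'a::euclidean_space set"
  assumes \<Omega>: "open \<Omega>" "bounded \<Omega>" and F: "compact F" and john: "\<Omega> \<subseteq> F \<times> {..<0}"
    and pos: "measure lebesgue F > 0"
  shows "sloshing_minmax \<Omega> F k < \<infinity>"
proof (rule ccontr)
  assume "\<not> ?thesis"
  then have top: "sloshing_minmax \<Omega> F (Suc k) = \<infinity>"
    using sloshing_minmax_mono[of \<Omega> F k] by (simp add: less_top[symmetric] top_unique)
  let ?d = "DIM('a)"
  define c where "c = measure lebesgue F * unit_ball_vol ?d / Suc ?d"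
  define C where "C = (2 * pi) ^ ?d * real k"
  have c: "c > 0" using pos by (simp add: c_def)
  \<comment> \<open>Chosen so that \<open>c * z = C + c\<close> exceeds \<open>C\<close>, whereas
    the bound and \<open>z \<ge> 1\<close> yield \<open>c * z \<le> C\<close>.\<close>
  define z where "z = C / c + 1"
  have z: "z \<ge> 1" using c by (simp add: z_def C_def)
  have "c * z ^ Suc ?d \<le> (2 * pi) ^ ?d * (\<Sum>i<k. z - enn2real (min (ennreal z) (sloshing_minmax \<Omega> F (Suc i))))"
    using riesz_mean_bound[OF \<Omega> F john, of z k] z top by (simp add: c_def)
  also have "\<dots> \<le> (2 * pi) ^ ?d * (\<Sum>i<k. z)"
    by (intro mult_left_mono sum_mono) auto
  finally have "z * (c * z ^ ?d) \<le> z * C" by (simp add: C_def mult_ac)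
  then have "c * z ^ ?d \<le> C" using z by simp
  moreover have "z ^ 1 \<le> z ^ ?d" using z by (intro power_increasing) auto
  then have "c * z \<le> c * z ^ ?d" using c by simp
  moreover have "c * z = C + c" using c by (simp add: z_def field_simps)
  ultimately show False using c by linarith
qed

text \<open>Bernoulli's inequality replaces the power of \<open>z / W\<close> by its tangent line at
  \<open>z = W\<close>; multiplied by \<open>z\<close>, this is a quadratic, and completing the
  square at \<open>W\<close> gives the parabola.\<close>

lemma le_parabola_of_power_bound:
  fixes z W A :: real
  assumes W: "W > 0" and z: "z \<ge> 0" and le: "z ^ Suc d / (real (Suc d) * W ^ d) \<le> z - A"
  shows "A \<le> real d / real (Suc d) * (W - 1 / W * (z - W)\<^sup>2)"
proof -
  have "1 + real d * (z / W - 1) \<le> (1 + (z / W - 1)) ^ d"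
    using W z by (intro Bernoulli_inequality) simp
  then have "z * (1 + real d * (z / W - 1)) \<le> z * (z / W) ^ d"
    using z by (intro mult_left_mono) auto
  also have "\<dots> = z ^ Suc d / W ^ d" by (simp add: power_divide)
  also have "\<dots> = real (Suc d) * (z ^ Suc d / (real (Suc d) * W ^ d))" by simp
  also have "\<dots> \<le> real (Suc d) * (z - A)" using le by (intro mult_left_mono) auto
  finally have 1: "real (Suc d) * A \<le> real (Suc d) * z - z * (1 + real d * (z / W - 1))"
    by (simp add: right_diff_distrib)
  have 2: "real (Suc d) * z - z * (1 + real d * (z / W - 1)) = real d * (W - 1 / W * (z - W)\<^sup>2)"
    using W by (simp add: field_simps power2_eq_square)
  have "A \<le> (real d * (W - 1 / W * (z - W)\<^sup>2)) / real (Suc d)"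
    using 1 unfolding 2 by (subst pos_le_divide_eq) (simp_all add: mult.commute)
  then show ?thesis by simp
qed

text \<open>Divided by \<open>W\<close>, the hypothesis says that the square of (z - W) / W is at
  most 1 - S. In particular 1 - S is nonnegative, and taking roots gives both ends of the
  interval.\<close>

lemma interval_of_parabola_bound:
  fixes z W A S :: real
  assumes W: "W > 0" and d: "d > 0" and le: "A \<le> d / (d + 1) * (W - 1 / W * (z - W)\<^sup>2)"
    and S: "S = (d + 1) / d * (A / W)"
  shows "S \<le> 1" and "W * (1 - sqrt (1 - S)) \<le> z" and "z \<le> W * (1 + sqrt (1 - S))"
proof -
  have "S \<le> (d + 1) / d * (d / (d + 1) * (W - 1 / W * (z - W)\<^sup>2) / W)"
    unfolding S using W d le by (intro mult_left_mono divide_right_mono) auto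
  also have "\<dots> = (W - 1 / W * (z - W)\<^sup>2) / W"
    using d by (simp add: divide_simps)
  also have "\<dots> = 1 - ((z - W) / W)\<^sup>2"
    using W by (simp add: field_simps power2_eq_square)
  finally have sq: "((z - W) / W)\<^sup>2 \<le> 1 - S" by simp
  then show "S \<le> 1" using zero_le_power2[of "(z - W) / W"] by linarith
  have "\<bar>(z - W) / W\<bar> \<le> sqrt (1 - S)" using sq real_sqrt_le_mono by fastforce
  then have "\<bar>z - W\<bar> \<le> W * sqrt (1 - S)"
    using W by (simp add: pos_divide_le_eq mult.commute)
  then show "W * (1 - sqrt (1 - S)) \<le> z" "z \<le> W * (1 + sqrt (1 - S))"
    by (auto simp: abs_le_iff algebra_simps)
qed

text \<open>The Weyl term is the frequency at which the semiclassical count in dimension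
  \<open>d\<close> equals \<open>k\<close>. Here \<open>d\<close> stands for n - 1.\<close>

lemma weyl_term_power:
  assumes d: "d \<ge> 1" and k: "k \<ge> 1" and A: "A > 0"
  shows "weyl_term (Suc d) k A > 0"
    and "unit_ball_vol d * A * weyl_term (Suc d) k A ^ d = (2 * pi) ^ d * real k"
proof -
  let ?w = "unit_ball_vol (real d)"
  have w: "?w > 0" by simp
  then have w0: "?w \<noteq> 0" by linarith
  have W: "weyl_term (Suc d) k A = 2 * pi * ?w powr (- 1 / d) * (real k / A) powr (1 / d)"
    by (simp add: weyl_term_def)
  show "weyl_term (Suc d) k A > 0" unfolding W using w k A by (intro mult_pos_pos) (auto simp del: unit_ball_vol_pos)
  have "(?w powr (- 1 / d)) ^ d = ?w powr (- 1)"
    by (subst powr_realpow[symmetric]) (use d w0 in \<open>auto simp: powr_powr\<close>)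
  then have p1: "(?w powr (- 1 / d)) ^ d = 1 / ?w" using w by (simp add: powr_minus_divide)
  have p2: "((real k / A) powr (1 / d)) ^ d = real k / A"
    using d k A by (subst powr_realpow[symmetric]) (auto simp: powr_powr)
  show "?w * A * weyl_term (Suc d) k A ^ d = (2 * pi) ^ d * real k"
    unfolding W power_mult_distrib[of _ _ d] p1 p2 using w0 A by simp
qed

text \<open>As \<open>B\<close> lies strictly below the plane, the free surface is the whole
  intersection of the compact frontier with that closed plane.\<close>

lemma compact_free_surface:
  fixes \<Omega> :: "('a::euclidean_space \<times> real) set"
  assumes "bounded \<Omega>" "frontier \<Omega> = F \<times> {0} \<union> B" "B \<subseteq> {x. snd x < 0}"
  shows "compact F"
proof -
  have "F \<times> {0} = frontier \<Omega> \<inter> {x. snd x = 0}" using assms(2,3) by auto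
  moreover have "closed {x :: 'a \<times> real. snd x = 0}"
    by (intro closed_Collect_eq continuous_intros)
  ultimately have "compact (F \<times> {0::real})"
    using assms(1) by (simp add: compact_Int_closed compact_frontier_bounded)
  then have "compact (fst ` (F \<times> {0::real}))"
    by (intro compact_continuous_image continuous_intros)
  then show ?thesis by simp
qed

text \<open>The Riesz mean bound at the largest admissible parameter, the eigenvalue of index k + 1.
  By monotonicity every minimum is then the eigenvalue itself, and \<open>weyl_term_power\<close>
  absorbs the constants into \<open>W\<close>.\<close>

lemma sloshing_eigenvalue_average_bound:
  fixes \<Omega> :: "('a::euclidean_space \<times> real) set"
  assumes adm: "admissible_domain \<Omega> F B" and john: "john_condition \<Omega> F" and k: "k \<ge> 1"
  defines "W \<equiv> weyl_term (Suc (DIM('a))) k (measure lebesgue F)"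
    and "z \<equiv> sloshing_eigenvalue \<Omega> F (Suc k)"
  shows "z ^ Suc (DIM('a)) / (real (Suc (DIM('a))) * W ^ DIM('a))
    \<le> z - (\<Sum>j=1..k. sloshing_eigenvalue \<Omega> F j) / real k"
proof -
  let ?d = "DIM('a)" and ?m = "sloshing_minmax \<Omega> F" and ?A = "measure lebesgue F"
  let ?T = "\<Sum>j=1..k. sloshing_eigenvalue \<Omega> F j" and ?w = "unit_ball_vol (real DIM('a))"
  have \<Omega>: "open \<Omega>" "bounded \<Omega>" and A: "?A > 0"
    using adm by (auto simp: admissible_domain_def)
  have F: "compact F" using adm by (auto simp: admissible_domain_def intro: compact_free_surface)
  have john': "\<Omega> \<subseteq> F \<times> {..<0}" using john by (simp add: john_condition_def)
  \<comment> \<open>Finiteness is essential: an infinite value would have been turned into 0 by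
    \<open>enn2real\<close>.\<close>
  have zm: "ennreal z = ?m (Suc k)"
    unfolding z_def sloshing_eigenvalue_def
    using sloshing_minmax_finite[OF \<Omega> F john' A, of "Suc k"] by simp
  have z0: "z \<ge> 0" by (simp add: z_def sloshing_eigenvalue_def)
  have "enn2real (min (ennreal z) (?m (Suc i))) = sloshing_eigenvalue \<Omega> F (Suc i)" if "i < k" for i
  proof -
    have "?m (Suc i) \<le> ?m (Suc k)"
      by (rule lift_Suc_mono_le[of ?m]) (use that in \<open>auto intro: sloshing_minmax_mono\<close>)
    then show ?thesis by (simp add: zm min_absorb2 sloshing_eigenvalue_def)
  qed
  then have "(\<Sum>i<k. z - enn2real (min (ennreal z) (?m (Suc i)))) = (\<Sum>i<k. z - sloshing_eigenvalue \<Omega> F (Suc i))"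
    by (intro sum.cong) auto
  also have "\<dots> = real k * z - ?T"
    by (simp add: sum_subtractf sum.atLeast1_atMost_eq)
  finally have D: "(\<Sum>i<k. z - enn2real (min (ennreal z) (?m (Suc i)))) = real k * z - ?T" .
  have W: "W > 0" "?w * ?A * W ^ ?d = (2 * pi) ^ ?d * real k"
    unfolding W_def using weyl_term_power[OF _ k A, of ?d] by (simp_all add: Suc_leI)
  have "?A * (?w * z ^ Suc ?d / Suc ?d) \<le> (2 * pi) ^ ?d * (real k * z - ?T)"
    using riesz_mean_bound[OF \<Omega> F john' z0, of k] zm D by simp
  also have "\<dots> = (2 * pi) ^ ?d * real k * (z - ?T / real k)"
    using k by (simp add: field_simps)
  also have "\<dots> = ?A * ?w * (W ^ ?d * (z - ?T / real k))"
    unfolding W(2)[symmetric] by simp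
  finally have "?A * ?w * (z ^ Suc ?d / Suc ?d) \<le> ?A * ?w * (W ^ ?d * (z - ?T / real k))"
    by (simp add: mult.assoc)
  moreover have "?A * ?w > 0" using A by simp
  ultimately have "z ^ Suc ?d / Suc ?d \<le> W ^ ?d * (z - ?T / real k)"
    by (simp only: mult_le_cancel_left_pos)
  then have "z ^ Suc ?d / Suc ?d / W ^ ?d \<le> z - ?T / real k"
    using W(1) by (subst pos_divide_le_eq) (auto simp: mult.commute)
  then show ?thesis by simp
qed

text \<open>The conjunct \<open>S \<le> 1\<close> certifies that the square roots are genuine, as
  \<open>sqrt\<close> is total in HOL.\<close>

theorem theorem1p4:
  fixes \<Omega> B :: "((real ^ 'd) \<times> real) set"
    and F :: "(real ^ 'd) set"
    and n k :: nat
    and \<nu> :: "nat \<Rightarrow> real"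
    and W S :: real
  assumes "n = DIM((real ^ 'd) \<times> real)"
    and "admissible_domain \<Omega> F B"
    and "john_condition \<Omega> F"
    and "k \<ge> 1"
    and "\<And>j. \<nu> j = sloshing_eigenvalue \<Omega> F j"
    and "W = weyl_term n k (measure lebesgue F)"
    and "S = real n / (real n - 1) * ((\<Sum>j=1..k. \<nu> j) / (real k * W))"
  shows "1 / real k * (\<Sum>j=1..k. \<nu> j)
           \<le> (real n - 1) / real n * (W - 1 / W * (\<nu> (k + 1) - W)\<^sup>2)
         \<and> S \<le> 1
         \<and> W * (1 - sqrt (1 - S)) \<le> \<nu> (k + 1)
         \<and> \<nu> (k + 1) \<le> W * (1 + sqrt (1 - S))"
proof -
  let ?d = "DIM(real ^ 'd)"
  have n: "n = Suc ?d" using assms(1) by (simp add: DIM_prod)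
  have A: "measure lebesgue F > 0" using assms(2) by (simp add: admissible_domain_def)
  have d: "real ?d > 0" by simp
  have W: "W > 0"
    unfolding assms(6) n by (rule weyl_term_power(1)) (use A assms(4) in \<open>auto simp: Suc_le_eq\<close>)
  have \<nu>0: "\<nu> (k + 1) \<ge> 0" by (simp add: assms(5) sloshing_eigenvalue_def)
  have "\<nu> (k + 1) ^ Suc ?d / (real (Suc ?d) * W ^ ?d) \<le> \<nu> (k + 1) - (\<Sum>j=1..k. \<nu> j) / real k"
    using sloshing_eigenvalue_average_bound[OF assms(2-4)] by (simp add: assms(5,6) n)
  from le_parabola_of_power_bound[OF W \<nu>0 this]
  have avg: "(\<Sum>j=1..k. \<nu> j) / real k \<le> real ?d / (real ?d + 1) * (W - 1 / W * (\<nu> (k + 1) - W)\<^sup>2)"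
    by (simp add: add.commute)
  have S: "S = (real ?d + 1) / real ?d * ((\<Sum>j=1..k. \<nu> j) / real k / W)"
    unfolding assms(7) n by (simp add: add.commute)
  show ?thesis
    using avg interval_of_parabola_bound[OF W d avg S] by (simp add: n add.commute)
qed

end
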